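(* Let $A\in\mathbb{R}^{m\times n}$ be a nonzero matrix with $m\ge n$, let $b\in\mathbb{R}^m$ be such that $Ax=b$ is consistent, let $\beta,\delta\in[m]$ with $\delta\le\beta$, and put $x^\star=A^{\dagger}b$, the least-Euclidean-norm solution of $Ax=b$. From an initial guess $x^0\in\operatorname{range}(A^T)$, the sequence $\{x^k\}_{k=0}^\infty$ generated by the randomized block subsampling Kaczmarz-Motzkin (RB-SKM) method with parameters $\beta,\delta$ converges linearly in expectation to $x^\star$. Moreover, for every $k\ge 0$, whenever the denominator in the definition of $\xi_k$ below is nonzero, $$\mathbb{E}^{k}\big[\|x^{k+1}-x^\star\|_2^2\big]\le\left(1-\frac{\delta}{\xi_k}\,\frac{\beta}{m}\,\frac{\lambda_{\min}^{+}(A^TA)}{\lambda_{\max}(A_{\mathcal{I}}^TA_{\mathcal{I}})}\right)\|x^k-x^\star\|_2^2,$$ where $$\lambda_{\max}^{-1}(A_{\mathcal{I}}^TA_{\mathcal{I}})=\min_{\mathcal{I}_k}\lambda_{\max}^{-1}(A_{\mathcal{I}_k}^TA_{\mathcal{I}_k})\quad\text{and}\quad \xi_k=\frac{\sum_{\tau_k\in\binom{[m]}{\beta}}\|A_{\tau_k}x^k-b_{\tau_k}\|_2^2}{\sum_{\tau_k\in\binom{[m]}{\beta}}\min_{i\in\mathcal{I}_k}\big(A^{(i)}x^k-b^{(i)}\big)^2}.$$ Here $\mathcal{I}_k=\mathcal{I}_k(\tau_k)$ is the index subset the method selects from $\tau_k$ at the iterate $x^k$, and the minimum over $\mathcal{I}_k$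 is taken over the subsets $\mathcal{I}_k(\tau_k)$ obtained as $\tau_k$ ranges over $\binom{[m]}{\beta}$.
   Context: Notation. $[m]=\{1,\dots,m\}$, and $\binom{[m]}{\beta}$ is the collection of all subsets of $[m]$ of size $\beta$. $A^{(i)}$ is the $i$th row of $A$ and $b^{(i)}$ is the $i$th entry of $b$. For $\tau\subseteq[m]$, $A_\tau$ and $b_\tau$ are the restrictions of $A$ and $b$ to the row indices in $\tau$. $A^\dagger$ is the Moore-Penrose pseudoinverse. $\operatorname{range}(A^T)$ is the column space of $A^T$. $\lambda_{\max}(M)$ and $\lambda_{\min}^{+}(M)$ are the largest eigenvalue and the smallest positive eigenvalue of a symmetric positive semidefinite matrix $M$; $\lambda_{\max}^{-1}(M)=1/\lambda_{\max}(M)$, with the convention $1/0=+\infty$. RB-SKM method. Given $\beta,\delta\in[m]$ with $\delta\le\beta$ and $x^0\in\mathbb{R}^n$, for $k=0,1,2,\dots$: 1. Select $\tau_k\subseteq[m]$ of size $\beta$ uniformly at random from $\binom{[m]}{\beta}$, independently of previous choices. 2. From $\tau_k$, determine the subset $\mathcal{I}_k\subseteq\tau_k$ of size $\delta$ consisting of the indices of the $\delta$ largest values of $|b^{(i)}-A^{(i)}x^k|$, $i\in\tau_k$; that is, $|b^{(i)}-A^{(i)}x^k|\ge|b^{(j)}-A^{(j)}x^k|$ for all $i\in\mathcal{I}_k$ and $j\in\tau_k\setminus\mathcal{I}_k$ (ties broken by any fixed rule, so that $\mathcal{I}_k$ is determined by $\tau_k$ and $x^k$). 3. Set $x^{k+1}=x^k+A_{\mathcal{I}_k}^\dagger(b_{\mathcal{I}_k}-A_{\mathcal{I}_k}x^k)$.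 $\mathbb{E}^k$ denotes the conditional expectation given the first $k$ iterations (so $x^k$ is fixed and only $\tau_k$ is random), and $\mathbb{E}$ denotes the full expectation. "Converges linearly in expectation to $x^\star$" means that there is a constant $\rho\in[0,1)$ with $\mathbb{E}[\|x^{k+1}-x^\star\|_2^2]\le\rho\,\mathbb{E}[\|x^k-x^\star\|_2^2]$ for all $k\ge0$. *)

theory Defs
  imports
    "HOL-Probability.Probability"
    "Jordan_Normal_Form.DL_Submatrix"
    "Jordan_Normal_Form.Spectral_Radius"
    "Jordan_Normal_Form.VS_Connect"
begin

(* Matrices and vectors are those of Jordan_Normal_Form; the session HOL-Analysis uses the same
   symbols and some of the same short names for its type-indexed vectors. *)
unbundle no inner_syntax and no vec_syntax

section \<open>Linear algebra\<close>

definition norm2 :: "real Matrix.vec \<Rightarrow> real" where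
  "norm2 v = sqrt (v \<bullet> v)"

definition is_pinv :: "real mat \<Rightarrow> real mat \<Rightarrow> bool" where
  "is_pinv A P \<longleftrightarrow> P \<in> carrier_mat (dim_col A) (dim_row A) \<and>
     A * P * A = A \<and> P * A * P = P \<and>
     transpose_mat (A * P) = A * P \<and> transpose_mat (P * A) = P * A"

text \<open>The Moore-Penrose pseudoinverse, as the unique solution of the four Penrose equations.\<close>

definition pinv :: "real mat \<Rightarrow> real mat" where
  "pinv A = (THE P. is_pinv A P)"

definition sub_rows :: "real mat \<Rightarrow> nat set \<Rightarrow> real mat" where
  "sub_rows A I = submatrix A I UNIV"

text \<open>The entries of a vector with index in \<open>I\<close>, in increasing order of the index, as in
  \<^const>\<open>submatrix\<close>.\<close>

definition sub_vec :: "real Matrix.vec \<Rightarrow> nat set \<Rightarrow> real Matrix.vec" where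
  "sub_vec v I = Matrix.vec (card {i. i < dim_vec v \<and> i \<in> I}) (\<lambda>k. v $ pick I k)"

definition gram :: "real mat \<Rightarrow> real mat" where
  "gram A = transpose_mat A * A"

definition lambda_max :: "real mat \<Rightarrow> real" where
  "lambda_max M = Max (spectrum M)"

definition lambda_min_pos :: "real mat \<Rightarrow> real" where
  "lambda_min_pos M = Min {\<mu> \<in> spectrum M. \<mu> > 0}"

text \<open>In the extended reals \<open>1 / 0 = \<infinity>\<close>, so this is \<open>\<infinity>\<close> for the zero matrix.\<close>

definition lambda_max_inv :: "real mat \<Rightarrow> ereal" where
  "lambda_max_inv M = 1 / ereal (lambda_max M)"

section \<open>The RB-SKM method\<close>

text \<open>Rows are numbered \<open>0, \<dots>, m - 1\<close>.\<close>

definition blocks :: "nat \<Rightarrow> nat \<Rightarrow> nat set set" where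
  "blocks m \<beta> = {\<tau>. \<tau> \<subseteq> {..<m} \<and> card \<tau> = \<beta>}"

definition residual :: "real mat \<Rightarrow> real Matrix.vec \<Rightarrow> real Matrix.vec \<Rightarrow> nat \<Rightarrow> real" where
  "residual A b x i = b $ i - row A i \<bullet> x"

text \<open>A rule \<open>sel\<close> choosing from each block \<open>\<tau>\<close>, at each point \<open>x\<close>, the indices of \<open>\<delta>\<close> largest
  absolute residuals. Ties may be broken in any way, but as a function of \<open>\<tau>\<close> and \<open>x\<close> only.\<close>

definition selection_rule ::
  "real mat \<Rightarrow> real Matrix.vec \<Rightarrow> nat \<Rightarrow> nat \<Rightarrow> (nat set \<Rightarrow> real Matrix.vec \<Rightarrow> nat set) \<Rightarrow> bool" where
  "selection_rule A b \<beta> \<delta> sel \<longleftrightarrow>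
     (\<forall>\<tau> \<in> blocks (dim_row A) \<beta>. \<forall>x \<in> carrier_vec (dim_col A).
        sel \<tau> x \<subseteq> \<tau> \<and> card (sel \<tau> x) = \<delta> \<and>
        (\<forall>i \<in> sel \<tau> x. \<forall>j \<in> \<tau> - sel \<tau> x. \<bar>residual A b x i\<bar> \<ge> \<bar>residual A b x j\<bar>))"

definition rbskm_step ::
  "real mat \<Rightarrow> real Matrix.vec \<Rightarrow> nat set \<Rightarrow> real Matrix.vec \<Rightarrow> real Matrix.vec" where
  "rbskm_step A b I x = x + pinv (sub_rows A I) *\<^sub>v (sub_vec b I - sub_rows A I *\<^sub>v x)"

text \<open>The iterates for a given sequence \<open>t\<close> of sampled blocks.\<close>

primrec rbskm ::
  "real mat \<Rightarrow> real Matrix.vec \<Rightarrow> (nat set \<Rightarrow> real Matrix.vec \<Rightarrow> nat set) \<Rightarrow> real Matrix.vec \<Rightarrow>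
   (nat \<Rightarrow> nat set) \<Rightarrow> nat \<Rightarrow> real Matrix.vec" where
  "rbskm A b sel x0 t 0 = x0"
| "rbskm A b sel x0 t (Suc k) =
     rbskm_step A b (sel (t k) (rbskm A b sel x0 t k)) (rbskm A b sel x0 t k)"

definition xi_num :: "real mat \<Rightarrow> real Matrix.vec \<Rightarrow> nat \<Rightarrow> real Matrix.vec \<Rightarrow> real" where
  "xi_num A b \<beta> x =
     (\<Sum>\<tau> \<in> blocks (dim_row A) \<beta>. (norm2 (sub_rows A \<tau> *\<^sub>v x - sub_vec b \<tau>))\<^sup>2)"

definition xi_den ::
  "real mat \<Rightarrow> real Matrix.vec \<Rightarrow> nat \<Rightarrow> (nat set \<Rightarrow> real Matrix.vec \<Rightarrow> nat set) \<Rightarrow>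
   real Matrix.vec \<Rightarrow> real" where
  "xi_den A b \<beta> sel x =
     (\<Sum>\<tau> \<in> blocks (dim_row A) \<beta>. MIN i \<in> sel \<tau> x. (row A i \<bullet> x - b $ i)\<^sup>2)"

definition xi ::
  "real mat \<Rightarrow> real Matrix.vec \<Rightarrow> nat \<Rightarrow> (nat set \<Rightarrow> real Matrix.vec \<Rightarrow> nat set) \<Rightarrow>
   real Matrix.vec \<Rightarrow> real" where
  "xi A b \<beta> sel x = xi_num A b \<beta> x / xi_den A b \<beta> sel x"

definition min_lambda_max_inv ::
  "real mat \<Rightarrow> nat \<Rightarrow> (nat set \<Rightarrow> real Matrix.vec \<Rightarrow> nat set) \<Rightarrow> real Matrix.vec \<Rightarrow> ereal" where
  "min_lambda_max_inv A \<beta> sel x =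
     (MIN \<tau> \<in> blocks (dim_row A) \<beta>. lambda_max_inv (gram (sub_rows A (sel \<tau> x))))"

section \<open>Randomness\<close>

text \<open>The random blocks \<open>T 0, T 1, \<dots>\<close> are independent and uniform on the \<open>\<beta>\<close>-subsets.
  Measurability of each \<open>T k\<close> as a map into \<open>blocks m \<beta>\<close> is part of \<^const>\<open>prob_space.indep_vars\<close>.\<close>

definition uniform_blocks :: "'w measure \<Rightarrow> nat \<Rightarrow> nat \<Rightarrow> (nat \<Rightarrow> 'w \<Rightarrow> nat set) \<Rightarrow> bool" where
  "uniform_blocks M m \<beta> T \<longleftrightarrow>
     prob_space.indep_vars M (\<lambda>_. count_space (blocks m \<beta>)) T UNIV \<and>
     (\<forall>k. distr M (count_space (blocks m \<beta>)) (T k) = uniform_count_measure (blocks m \<beta>))"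

text \<open>The \<open>\<sigma>\<close>-algebra generated by \<open>T 0, \<dots>, T (k - 1)\<close>, that is, by the first \<open>k\<close> iterations.\<close>

definition history :: "'w measure \<Rightarrow> nat \<Rightarrow> nat \<Rightarrow> (nat \<Rightarrow> 'w \<Rightarrow> nat set) \<Rightarrow> nat \<Rightarrow> 'w measure" where
  "history M m \<beta> T k =
     vimage_algebra (space M) (\<lambda>\<omega>. \<lambda>j\<in>{..<k}. T j \<omega>) (\<Pi>\<^sub>M j\<in>{..<k}. count_space (blocks m \<beta>))"

text \<open>Integrability is demanded because the expectation of a non-integrable function is \<open>0\<close>.\<close>

definition converges_linearly_in_expectation ::
  "'w measure \<Rightarrow> (nat \<Rightarrow> 'w \<Rightarrow> real Matrix.vec) \<Rightarrow> real Matrix.vec \<Rightarrow> bool" where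
  "converges_linearly_in_expectation M X xs \<longleftrightarrow>
     (\<forall>k. integrable M (\<lambda>\<omega>. (norm2 (X k \<omega> - xs))\<^sup>2)) \<and>
     (\<exists>\<rho>. 0 \<le> \<rho> \<and> \<rho> < 1 \<and>
        (\<forall>k. prob_space.expectation M (\<lambda>\<omega>. (norm2 (X (Suc k) \<omega> - xs))\<^sup>2)
           \<le> \<rho> * prob_space.expectation M (\<lambda>\<omega>. (norm2 (X k \<omega> - xs))\<^sup>2)))"

end

theory Submission
  imports Defs
begin

text \<open>For \<open>A z = b\<close> and \<open>e = x - z\<close>, a step along the rows \<open>I\<close> replaces \<open>e\<close> by \<open>e - P e\<close>, where
  \<open>P\<close> is the orthogonal projection onto the row space of \<open>A\<^sub>I\<close>. The squared error thus drops by
  \<open>\<bar>P e\<bar>\<^sup>2 \<ge> \<bar>A\<^sub>I e\<bar>\<^sup>2 / \<lambda>\<^sub>m\<^sub>a\<^sub>x\<close>, and \<open>\<bar>A\<^sub>I e\<bar>\<^sup>2\<close> is at least \<open>\<delta>\<close> times the smallest squared residual in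
  \<open>I\<close>. Averaging over the blocks, in which every row occurs equally often, turns this into \<open>\<bar>A e\<bar>\<^sup>2\<close>, and
  \<open>e\<close> stays in the row space of \<open>A\<close>, where \<open>\<bar>A e\<bar>\<^sup>2 \<ge> \<lambda>\<^sub>m\<^sub>i\<^sub>n\<^sup>+ \<bar>e\<bar>\<^sup>2\<close>.\<close>

text \<open>The rate in the conditional estimate depends on the iterate, and the estimate is silent
  where \<open>xi_den\<close> vanishes; this happens at nonzero errors, for instance when a single
  row has a nonzero residual and \<delta> \<ge> 2. It therefore does not yield one constant for all
  steps, and linear convergence rests on a separate one-step bound,
  \<open>mean_err_contraction\<close>. Since \<open>lambda_max\<close> and
  \<open>lambda_min_pos\<close> are \<open>Max\<close> and \<open>Min\<close> over a set of
  eigenvalues, that set has to be tied to quadratic forms. One fact serves both: a maximiser of the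
  Rayleigh quotient of a symmetric matrix is an eigenvector. All estimates are proved pointwise for
  a finite average over blocks. Up to step \<open>k\<close> there are only finitely many sequences
  of blocks, so the iterates take finitely many values, and independence and uniformity identify the
  average with a conditional expectation.\<close>

section \<open>The Moore-Penrose pseudoinverse\<close>

text \<open>Gram-Schmidt: \<open>p\<close> is the part of the last vector orthogonal to the earlier ones. If \<open>p = 0\<close>
  then \<open>t = x / 0 = 0\<close>, and nothing has to be subtracted.\<close>

lemma orthogonal_residual_exists:
  fixes a :: "nat \<Rightarrow> nat \<Rightarrow> real" and b :: "nat \<Rightarrow> real"
  shows "\<exists>c. \<forall>i<n. (\<Sum>k<m. a i k * (b k - (\<Sum>j<n. c j * a j k))) = 0"
proof (induction n arbitrary: b)
  case 0
  show ?case by simp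
next
  case (Suc n)
  obtain c where c: "\<And>i. i < n \<Longrightarrow> (\<Sum>k<m. a i k * (b k - (\<Sum>j<n. c j * a j k))) = 0"
    using Suc.IH[of b] by blast
  obtain d where d: "\<And>i. i < n \<Longrightarrow> (\<Sum>k<m. a i k * (a n k - (\<Sum>j<n. d j * a j k))) = 0"
    using Suc.IH[of "a n"] by blast
  define p where "p k = a n k - (\<Sum>j<n. d j * a j k)" for k
  define r where "r k = b k - (\<Sum>j<n. c j * a j k)" for k
  define q where "q = (\<Sum>k<m. p k * p k)"
  define t where "t = (\<Sum>k<m. p k * r k) / q"
  have orth_old: "(\<Sum>k<m. a i k * (r k - t * p k)) = 0" if "i < n" for i
  proof -
    have "(\<Sum>k<m. a i k * (r k - t * p k)) = (\<Sum>k<m. a i k * r k) - t * (\<Sum>k<m. a i k * p k)"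
      by (simp add: sum_subtractf right_diff_distrib sum_distrib_left mult.left_commute)
    then show ?thesis
      using c[OF that] d[OF that] by (simp add: p_def r_def)
  qed
  have orth_p: "(\<Sum>k<m. p k * (r k - t * p k)) = 0"
  proof (cases "q = 0")
    case True
    then have "p k = 0" if "k < m" for k
      using that by (auto simp: q_def sum_nonneg_eq_0_iff)
    then show ?thesis by simp
  next
    case False
    have "(\<Sum>k<m. p k * (r k - t * p k)) = (\<Sum>k<m. p k * r k) - t * q"
      by (simp add: q_def sum_subtractf right_diff_distrib sum_distrib_left mult.left_commute)
    then show ?thesis using False by (simp add: t_def)
  qed
  have orth_new: "(\<Sum>k<m. a n k * (r k - t * p k)) = 0"
  proof -
    have "(\<Sum>k<m. a n k * (r k - t * p k))
        = (\<Sum>k<m. p k * (r k - t * p k) + (\<Sum>j<n. d j * (a j k * (r k - t * p k))))"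
    proof (rule sum.cong)
      fix k
      have "a n k = p k + (\<Sum>j<n. d j * a j k)"
        by (simp add: p_def)
      then have "a n k * s = p k * s + (\<Sum>j<n. d j * (a j k * s))" for s
        by (simp add: distrib_right sum_distrib_right mult.assoc)
      then show "a n k * (r k - t * p k)
          = p k * (r k - t * p k) + (\<Sum>j<n. d j * (a j k * (r k - t * p k)))" .
    qed simp
    also have "\<dots> = (\<Sum>j<n. d j * (\<Sum>k<m. a j k * (r k - t * p k)))"
      using orth_p sum.swap[of "\<lambda>k j. d j * (a j k * (r k - t * p k))" "{..<n}" "{..<m}"]
      by (simp add: sum.distrib sum_distrib_left)
    also have "\<dots> = 0"
      using orth_old by simp
    finally show ?thesis .
  qed
  \<comment> \<open>Expanding \<open>p\<close>, the vector \<open>r - t * p\<close> subtracts from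
    \<open>b\<close> each \<open>a j\<close> with weight \<open>c j - t * d j\<close> and
    \<open>a n\<close> with weight \<open>t\<close>.\<close>
  define c' where "c' j = (if j < n then c j - t * d j else t)" for j
  have "b k - (\<Sum>j<Suc n. c' j * a j k) = r k - t * p k" for k
    by (simp add: c'_def r_def p_def algebra_simps sum_subtractf sum_distrib_left)
  then show ?case
    using orth_old orth_new by (intro exI[of _ c']) (auto simp: less_Suc_eq)
qed

text \<open>The normal equations express that \<open>b - A x\<close> is orthogonal to every column
  of \<open>A\<close>, so \<open>orthogonal_residual_exists\<close> is applied to the
  columns.\<close>

lemma normal_equation_solvable:
  fixes A :: "real mat"
  assumes A: "A \<in> carrier_mat m n" and b: "b \<in> carrier_vec m"
  obtains x where "x \<in> carrier_vec n" "A\<^sup>T *\<^sub>v (A *\<^sub>v x) = A\<^sup>T *\<^sub>v b"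
proof -
  obtain c where c: "\<And>i. i < n \<Longrightarrow> (\<Sum>k<m. A $$ (k, i) * (b $ k - (\<Sum>j<n. c j * A $$ (k, j)))) = 0"
    using orthogonal_residual_exists[where n=n and m=m and a="\<lambda>i k. A $$ (k, i)" and b="\<lambda>k. b $ k"] by blast
  define x where "x = Matrix.vec n c"
  have Ax: "(A *\<^sub>v x) $ k = (\<Sum>j<n. c j * A $$ (k, j))" if "k < m" for k
    using A that by (auto simp: x_def scalar_prod_def lessThan_atLeast0 mult.commute intro!: sum.cong)
  have "(A\<^sup>T *\<^sub>v (A *\<^sub>v x)) $ i = (A\<^sup>T *\<^sub>v b) $ i" if "i < n" for i
  proof -
    have "(A\<^sup>T *\<^sub>v b) $ i - (A\<^sup>T *\<^sub>v (A *\<^sub>v x)) $ i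
        = (\<Sum>k<m. A $$ (k, i) * (b $ k - (A *\<^sub>v x) $ k))"
      using A b that
      by (simp add: scalar_prod_def lessThan_atLeast0 right_diff_distrib sum_subtractf)
    then show ?thesis using c[OF that] Ax by simp
  qed
  then have "A\<^sup>T *\<^sub>v (A *\<^sub>v x) = A\<^sup>T *\<^sub>v b"
    using A by (intro eq_vecI) auto
  then show thesis using that[of x] by (simp add: x_def)
qed

text \<open>Column \<open>j\<close> of \<open>X\<close> solves the normal equations for the unit
  vector \<open>j\<close>.\<close>

lemma normal_equation_solvable_mat:
  fixes A :: "real mat"
  assumes A: "A \<in> carrier_mat m n"
  obtains X where "X \<in> carrier_mat n m" "A\<^sup>T * A * X = A\<^sup>T"
proof -
  have "\<exists>x. x \<in> carrier_vec n \<and> A\<^sup>T *\<^sub>v (A *\<^sub>v x) = A\<^sup>T *\<^sub>v unit_vec m j" for j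
    using normal_equation_solvable[OF A, of "unit_vec m j"] by auto
  then obtain x where x: "\<And>j. x j \<in> carrier_vec n"
    "\<And>j. A\<^sup>T *\<^sub>v (A *\<^sub>v x j) = A\<^sup>T *\<^sub>v unit_vec m j" by metis
  define X where "X = Matrix.mat n m (\<lambda>(i, j). x j $ i)"
  have X: "X \<in> carrier_mat n m" by (simp add: X_def)
  have colX: "col X j = x j" if "j < m" for j
    using x(1)[of j] that by (intro eq_vecI) (auto simp: X_def)
  have "A\<^sup>T * A * X = A\<^sup>T"
  proof (rule mat_col_eqI)
    fix j assume "j < dim_col A\<^sup>T"
    then have j: "j < m" using A by simp
    have "col (A\<^sup>T * A * X) j = (A\<^sup>T * A) *\<^sub>v x j"
      using A X j colX by (subst col_mult2[of _ n n _ m]) auto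
    also have "\<dots> = A\<^sup>T *\<^sub>v unit_vec m j"
      using A x(1)[of j] x(2)[of j] by (subst assoc_mult_mat_vec[of _ n m _ n]) auto
    also have "\<dots> = col A\<^sup>T j"
      using A j by (intro eq_vecI) (auto simp: scalar_prod_right_unit)
    finally show "col (A\<^sup>T * A * X) j = col A\<^sup>T j" .
  qed (use A X in auto)
  then show thesis using that X by blast
qed

text \<open>Multiplying \<open>A\<^sup>T * A * X = A\<^sup>T\<close> on the left by
  \<open>X\<^sup>T\<close> shows that the transpose of \<open>C = A * X\<close> equals
  \<open>C\<^sup>T * C\<close>, so \<open>C\<close> is symmetric; transposing the same equation then
  gives \<open>A * X * A = A\<close>.\<close>

lemma least_squares_inverse_exists:
  fixes A :: "real mat"
  assumes A: "A \<in> carrier_mat m n"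
  obtains X where "X \<in> carrier_mat n m" "A * X * A = A" "(A * X)\<^sup>T = A * X"
proof -
  obtain X where X: "X \<in> carrier_mat n m" and eq: "A\<^sup>T * A * X = A\<^sup>T"
    using normal_equation_solvable_mat[OF A] .
  have AX: "A * X \<in> carrier_mat m m" using A X by simp
  have At: "A\<^sup>T \<in> carrier_mat n m" and Xt: "X\<^sup>T \<in> carrier_mat m n" using A X by auto
  have eq': "A\<^sup>T * (A * X) = A\<^sup>T"
    using eq A X by (simp add: assoc_mult_mat[OF At A X])
  have tr: "(A * X)\<^sup>T = X\<^sup>T * A\<^sup>T" using transpose_mult[OF A X] .
  have "(A * X)\<^sup>T = (A * X)\<^sup>T * (A * X)"
    unfolding tr using eq' assoc_mult_mat[OF Xt At AX] by simp
  moreover have "((A * X)\<^sup>T * (A * X))\<^sup>T = (A * X)\<^sup>T * (A * X)"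
    using AX transpose_mult[of "(A * X)\<^sup>T" m m "A * X" m] by simp
  ultimately have sym: "(A * X)\<^sup>T = A * X"
    by (metis Matrix.transpose_transpose)
  have "(A * X)\<^sup>T * A = (A\<^sup>T * (A * X))\<^sup>T"
    using transpose_mult[OF At AX] by simp
  then have "A * X * A = A"
    using sym eq' by simp
  then show thesis using that X sym by blast
qed

text \<open>If \<open>A X\<close> and \<open>Z A\<close> are symmetric and \<open>A X A = A = A Z A\<close>, then \<open>Z A X\<close> satisfies all four
  Penrose equations; \<open>Z\<close> is obtained from a least-squares inverse of the transpose.\<close>

lemma is_pinv_exists:
  fixes A :: "real mat"
  shows "\<exists>P. is_pinv A P"
proof -
  define m n where "m = dim_row A" and "n = dim_col A"
  have A: "A \<in> carrier_mat m n" by (simp add: m_def n_def)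
  then have At: "A\<^sup>T \<in> carrier_mat n m" by simp
  obtain X where X: "X \<in> carrier_mat n m" "A * X * A = A" "(A * X)\<^sup>T = A * X"
    using least_squares_inverse_exists[OF A] .
  obtain Y where Y: "Y \<in> carrier_mat m n" "A\<^sup>T * Y * A\<^sup>T = A\<^sup>T" "(A\<^sup>T * Y)\<^sup>T = A\<^sup>T * Y"
    using least_squares_inverse_exists[OF At] .
  define Z where "Z = Y\<^sup>T"
  have Z: "Z \<in> carrier_mat n m" using Y by (simp add: Z_def)
  have ZA: "Z * A = A\<^sup>T * Y"
    using transpose_mult[OF At Y(1)] Y(3) by (simp add: Z_def)
  then have Zsym: "(Z * A)\<^sup>T = Z * A" using Y(3) by simp
  have "A * Z * A = A * (Z * A)" using assoc_mult_mat[OF A Z A] .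
  also have "\<dots> = (A\<^sup>T * Y * A\<^sup>T)\<^sup>T"
    using transpose_mult[of "A\<^sup>T * Y" n n "A\<^sup>T" m] At Y Zsym ZA by simp
  finally have AZA: "A * Z * A = A" using Y(2) by simp
  have car: "A * Z \<in> carrier_mat m m" "Z * A \<in> carrier_mat n n" "A * X \<in> carrier_mat m m"
    "X * A \<in> carrier_mat n n" using A X Z by auto
  define P where "P = Z * (A * X)"
  have P: "P \<in> carrier_mat n m" using A X Z by (auto simp: P_def)
  have AP: "A * P = A * X"
    using assoc_mult_mat[OF A Z car(3)] assoc_mult_mat[OF car(1) A X(1)] AZA by (simp add: P_def)
  have PA: "P * A = Z * A"
    using assoc_mult_mat[OF Z car(3) A] X(2) by (simp add: P_def)
  have "P * A * P = Z * (A * P)"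
    unfolding PA using assoc_mult_mat[OF Z A P] .
  then have "P * A * P = P" unfolding AP by (simp add: P_def)
  then have "is_pinv A P"
    using P AP PA X Zsym by (simp add: is_pinv_def m_def n_def)
  then show ?thesis by blast
qed

text \<open>\<open>A * P\<close> and \<open>A * Q\<close> absorb each other, and transposition swaps
  the factors of their product; being symmetric, they agree. The same holds for \<open>P * A\<close>
  and \<open>Q * A\<close>, and then \<open>P = P A P = Q A P = Q A Q = Q\<close>.\<close>

lemma is_pinv_unique:
  fixes A :: "real mat"
  assumes "is_pinv A P" "is_pinv A Q"
  shows "P = Q"
proof -
  define m n where "m = dim_row A" and "n = dim_col A"
  have A: "A \<in> carrier_mat m n" by (simp add: m_def n_def)
  have P: "P \<in> carrier_mat n m" "A * P * A = A" "P * A * P = P" "(A * P)\<^sup>T = A * P" "(P * A)\<^sup>T = P * A"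
    and Q: "Q \<in> carrier_mat n m" "A * Q * A = A" "Q * A * Q = Q" "(A * Q)\<^sup>T = A * Q" "(Q * A)\<^sup>T = Q * A"
    using assms by (simp_all add: is_pinv_def m_def n_def)
  have car: "A * P \<in> carrier_mat m m" "P * A \<in> carrier_mat n n"
    "A * Q \<in> carrier_mat m m" "Q * A \<in> carrier_mat n n" using A P Q by auto
  have APQ: "A * P * (A * Q) = A * Q"
    using assoc_mult_mat[OF car(1) A Q(1)] P(2) by simp
  have AQP: "A * Q * (A * P) = A * P"
    using assoc_mult_mat[OF car(3) A P(1)] Q(2) by simp
  have "(A * P * (A * Q))\<^sup>T = A * Q * (A * P)"
    using transpose_mult[OF car(1,3)] P(4) Q(4) by simp
  then have AeqA: "A * P = A * Q" using APQ AQP Q(4) by simp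
  have PQ: "P * A * (Q * A) = P * A"
    using assoc_mult_mat[OF P(1) A car(4)] assoc_mult_mat[OF A Q(1) A] Q(2) by simp
  have QP: "Q * A * (P * A) = Q * A"
    using assoc_mult_mat[OF Q(1) A car(2)] assoc_mult_mat[OF A P(1) A] P(2) by simp
  have "(P * A * (Q * A))\<^sup>T = Q * A * (P * A)"
    using transpose_mult[OF car(2,4)] P(5) Q(5) by simp
  then have eqA: "P * A = Q * A" using PQ QP P(5) by simp
  have "P = Q * A * P" using P(3) eqA by simp
  also have "\<dots> = Q * (A * Q)" using assoc_mult_mat[OF Q(1) A P(1)] AeqA by simp
  also have "\<dots> = Q" using assoc_mult_mat[OF Q(1) A Q(1)] Q(3) by simp
  finally show ?thesis .
qed

lemma is_pinv_pinv: "is_pinv A (pinv A)"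
  unfolding pinv_def using is_pinv_exists is_pinv_unique by (metis theI)

lemma
  fixes A :: "real mat"
  assumes "A \<in> carrier_mat m n"
  shows pinv_carrier: "pinv A \<in> carrier_mat n m"
    and mult_pinv_mult: "A * pinv A * A = A"
    and pinv_mult_symmetric: "(pinv A * A)\<^sup>T = pinv A * A"
  using is_pinv_pinv[of A] assms by (auto simp: is_pinv_def)

section \<open>Orthogonal projection onto the row space\<close>

lemma scalar_prod_self_nonneg: "(v :: real Matrix.vec) \<bullet> v \<ge> 0"
  by (simp add: scalar_prod_def sum_nonneg)

lemma scalar_prod_self_eq_0:
  assumes "(v :: real Matrix.vec) \<bullet> v = 0" "v \<in> carrier_vec n"
  shows "v = 0\<^sub>v n"
  using assms by (intro eq_vecI) (auto simp: scalar_prod_def sum_nonneg_eq_0_iff)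

lemma norm2_power2: "(norm2 v)\<^sup>2 = v \<bullet> v"
  by (simp add: norm2_def scalar_prod_self_nonneg)

text \<open>The matrix \<open>pinv B * B\<close> is the orthogonal projection onto the row space of
  \<open>B\<close>. Membership of \<open>v\<close> in the row space is expressed below by
  \<open>row_proj B v = v\<close>.\<close>

definition row_proj :: "real mat \<Rightarrow> real Matrix.vec \<Rightarrow> real Matrix.vec" where
  "row_proj B v = (pinv B * B) *\<^sub>v v"

context
  fixes B :: "real mat" and d n :: nat
  assumes B: "B \<in> carrier_mat d n"
begin

lemma pinv_mult_carrier: "pinv B * B \<in> carrier_mat n n"
  using B pinv_carrier[OF B] by simp

lemma row_proj_carrier [simp]: "row_proj B v \<in> carrier_vec n"
  using pinv_carrier[OF B] by (intro carrier_vecI) (simp add: row_proj_def)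

lemma mult_row_proj:
  assumes "v \<in> carrier_vec n"
  shows "B *\<^sub>v row_proj B v = B *\<^sub>v v"
proof -
  have "B * (pinv B * B) = B"
    using assoc_mult_mat[OF B pinv_carrier[OF B] B] mult_pinv_mult[OF B] by simp
  then show ?thesis
    using assoc_mult_mat_vec[OF B pinv_mult_carrier assms] by (simp add: row_proj_def)
qed

lemma row_proj_idem:
  assumes "v \<in> carrier_vec n"
  shows "row_proj B (row_proj B v) = row_proj B v"
  using assoc_mult_mat_vec[OF pinv_carrier[OF B] B assms]
    assoc_mult_mat_vec[OF pinv_carrier[OF B] B row_proj_carrier[of v]]
    mult_row_proj[OF assms]
  by (simp add: row_proj_def)

lemma row_proj_symmetric:
  assumes "u \<in> carrier_vec n" "v \<in> carrier_vec n"
  shows "row_proj B u \<bullet> v = u \<bullet> row_proj B v"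
  using transpose_vec_mult_scalar[OF pinv_mult_carrier assms(2,1)] pinv_mult_symmetric[OF B]
  by (simp add: row_proj_def)

lemma row_proj_pythagoras:
  assumes "v \<in> carrier_vec n"
  shows "(v - row_proj B v) \<bullet> (v - row_proj B v) = v \<bullet> v - row_proj B v \<bullet> row_proj B v"
proof -
  have "row_proj B v \<bullet> row_proj B v = v \<bullet> row_proj B v"
    using row_proj_symmetric[OF assms row_proj_carrier] row_proj_idem[OF assms] by simp
  moreover have "row_proj B v \<bullet> v = v \<bullet> row_proj B v"
    using assms by (intro comm_scalar_prod[of _ n]) auto
  ultimately show ?thesis
    using assms by (simp add: minus_scalar_prod_distrib[of _ n] scalar_prod_minus_distrib[of _ n])
qed

text \<open>Transpose \<open>B * (pinv B * B) = B\<close> and use that the projection is symmetric.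
  This makes the starting point \<open>x0\<close> and every vector \<open>A\<^sup>T (A v)\<close>
  fixed points of the projection.\<close>

lemma row_proj_transpose:
  assumes "y \<in> carrier_vec d"
  shows "row_proj B (B\<^sup>T *\<^sub>v y) = B\<^sup>T *\<^sub>v y"
proof -
  have "(B * (pinv B * B))\<^sup>T = (pinv B * B)\<^sup>T * B\<^sup>T"
    using transpose_mult[OF B pinv_mult_carrier] .
  moreover have "B * (pinv B * B) = B"
    using assoc_mult_mat[OF B pinv_carrier[OF B] B] mult_pinv_mult[OF B] by simp
  ultimately have "pinv B * B * B\<^sup>T = B\<^sup>T" using pinv_mult_symmetric[OF B] by simp
  then show ?thesis
    using assoc_mult_mat_vec[OF pinv_mult_carrier, of "B\<^sup>T" d y] B assms by (simp add: row_proj_def)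
qed

end

section \<open>Extreme eigenvalues\<close>

text \<open>The dimension \<open>n\<close> is a number, not a type, so the unit sphere is modelled
  by functions vanishing from \<open>n\<close> on, in the product topology. It is closed in a
  product of intervals and points, which is compact by Tychonoff's theorem.\<close>

lemma compact_unit_sphere_fun:
  "compact {f :: nat \<Rightarrow> real. (\<forall>i\<ge>n. f i = 0) \<and> (\<Sum>i<n. f i * f i) = 1}"
proof -
  define B where "B i = (if i < n then {- 1..1} else {0 :: real})" for i
  have "compactin (product_topology (\<lambda>i. euclidean) UNIV) (PiE UNIV B)"
    by (subst compactin_PiE) (auto simp: B_def)
  then have "compact (PiE UNIV B)"
    by (simp add: euclidean_product_topology)
  moreover have "closed {f :: nat \<Rightarrow> real. (\<Sum>i<n. f i * f i) = 1}"
    by (intro closed_Collect_eq continuous_intros continuous_on_product_coordinates)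
  ultimately have "compact (PiE UNIV B \<inter> {f. (\<Sum>i<n. f i * f i) = 1})"
    by (rule compact_Int_closed)
  moreover have "PiE UNIV B \<inter> {f. (\<Sum>i<n. f i * f i) = 1}
      = {f. (\<forall>i\<ge>n. f i = 0) \<and> (\<Sum>i<n. f i * f i) = 1}"
  proof (intro equalityI subsetI)
    fix f assume f: "f \<in> {f :: nat \<Rightarrow> real. (\<forall>i\<ge>n. f i = 0) \<and> (\<Sum>i<n. f i * f i) = 1}"
    have "\<bar>f i\<bar> \<le> 1" if "i < n" for i
    proof -
      have "f i * f i \<le> (\<Sum>i<n. f i * f i)"
        using that by (intro member_le_sum) auto
      then show ?thesis using f abs_square_le_1[of "f i"] by (auto simp: power2_eq_square)
    qed
    then show "f \<in> PiE UNIV B \<inter> {f. (\<Sum>i<n. f i * f i) = 1}"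
      using f by (auto simp: B_def abs_le_iff)
  next
    fix f assume f: "f \<in> PiE UNIV B \<inter> {f. (\<Sum>i<n. f i * f i) = 1}"
    then have "f i \<in> B i" for i by auto
    then show "f \<in> {f. (\<forall>i\<ge>n. f i = 0) \<and> (\<Sum>i<n. f i * f i) = 1}"
      using f by (auto simp: B_def) (metis linorder_not_less singletonD)
  qed
  ultimately show ?thesis by simp
qed

text \<open>A continuous form attains its maximum on the compact sphere; scaling by the norm extends
  the inequality to all vectors.\<close>

lemma rayleigh_quotient_attained:
  fixes S :: "real mat"
  assumes S: "S \<in> carrier_mat n n" and n: "n > 0"
  obtains v where "v \<in> carrier_vec n" "v \<bullet> v = 1"
    "\<And>w. w \<in> carrier_vec n \<Longrightarrow> w \<bullet> (S *\<^sub>v w) \<le> (v \<bullet> (S *\<^sub>v v)) * (w \<bullet> w)"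
proof -
  define K where "K = {f :: nat \<Rightarrow> real. (\<forall>i\<ge>n. f i = 0) \<and> (\<Sum>i<n. f i * f i) = 1}"
  define F where "F f = (\<Sum>i<n. f i * (\<Sum>j<n. S $$ (i, j) * f j))" for f :: "nat \<Rightarrow> real"
  have F_vec: "Matrix.vec n f \<bullet> (S *\<^sub>v Matrix.vec n f) = F f" for f
    using S by (simp add: scalar_prod_def F_def lessThan_atLeast0)
  have norm_vec: "Matrix.vec n f \<bullet> Matrix.vec n f = (\<Sum>i<n. f i * f i)" for f :: "nat \<Rightarrow> real"
    by (simp add: scalar_prod_def lessThan_atLeast0)
  have "(\<lambda>i. if i = 0 then 1 else 0) \<in> K"
    using n by (auto simp: K_def if_distrib[of "\<lambda>x. x * _"] cong: if_cong)
  then have "K \<noteq> {}" by blast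
  moreover have "continuous_on K F"
    unfolding F_def
    by (intro continuous_intros continuous_on_subset[OF continuous_on_product_coordinates]) auto
  ultimately obtain f where f: "f \<in> K" "\<And>g. g \<in> K \<Longrightarrow> F g \<le> F f"
    using continuous_attains_sup[of K F] compact_unit_sphere_fun[of n] unfolding K_def by blast
  define v where "v = Matrix.vec n f"
  have "w \<bullet> (S *\<^sub>v w) \<le> (v \<bullet> (S *\<^sub>v v)) * (w \<bullet> w)" if w: "w \<in> carrier_vec n" for w
  proof (cases "w \<bullet> w = 0")
    case True
    then have "w = 0\<^sub>v n" using scalar_prod_self_eq_0 w by blast
    then show ?thesis using S by simp
  next
    case False
    then have pos: "w \<bullet> w > 0" using scalar_prod_self_nonneg[of w] by simp
    define s where "s = sqrt (w \<bullet> w)"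
    have s: "s > 0" "s * s = w \<bullet> w" using pos by (simp_all add: s_def)
    define g where "g i = (if i < n then w $ i / s else 0)" for i
    have vg: "Matrix.vec n g = (1 / s) \<cdot>\<^sub>v w"
      using w by (intro eq_vecI) (auto simp: g_def)
    have "(\<Sum>i<n. g i * g i) = 1"
      unfolding norm_vec[symmetric] vg using w s pos by (simp add: field_simps)
    then have "g \<in> K" by (simp add: K_def g_def)
    then have "F g \<le> F f" by (rule f(2))
    moreover have "F g = (w \<bullet> (S *\<^sub>v w)) / (s * s)"
      unfolding F_vec[symmetric] vg using w S by (simp add: mult_mat_vec[of _ n n])
    ultimately show ?thesis
      using s pos by (simp add: F_vec v_def divide_le_eq mult.commute)
  qed
  moreover have "v \<bullet> v = 1" using f(1) by (simp add: v_def norm_vec K_def)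
  moreover have "v \<in> carrier_vec n" by (simp add: v_def)
  ultimately show thesis using that by blast
qed

text \<open>The maximiser \<open>v\<close> of the Rayleigh quotient is an eigenvector: moving from \<open>v\<close> in the direction
  \<open>z = S v - \<mu> v\<close> would increase the quotient to first order by \<open>2 (z \<bullet> z)\<close>.\<close>

lemma symmetric_top_eigenvector:
  fixes S :: "real mat"
  assumes S: "S \<in> carrier_mat n n" and sym: "S\<^sup>T = S" and n: "n > 0"
  obtains \<mu> v where "v \<in> carrier_vec n" "v \<bullet> v = 1" "S *\<^sub>v v = \<mu> \<cdot>\<^sub>v v"
    "\<And>w. w \<in> carrier_vec n \<Longrightarrow> w \<bullet> (S *\<^sub>v w) \<le> \<mu> * (w \<bullet> w)"
proof -
  obtain v where v: "v \<in> carrier_vec n" "v \<bullet> v = 1"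
    "\<And>w. w \<in> carrier_vec n \<Longrightarrow> w \<bullet> (S *\<^sub>v w) \<le> (v \<bullet> (S *\<^sub>v v)) * (w \<bullet> w)"
    using rayleigh_quotient_attained[OF S n] by blast
  define \<mu> where "\<mu> = v \<bullet> (S *\<^sub>v v)"
  define z where "z = S *\<^sub>v v - \<mu> \<cdot>\<^sub>v v"
  have Sv: "S *\<^sub>v v \<in> carrier_vec n" using S v(1) by simp
  have z: "z \<in> carrier_vec n" using Sv v(1) by (simp add: z_def)
  have Sz: "S *\<^sub>v z \<in> carrier_vec n" using S z by simp
  define a where "a = z \<bullet> z"
  define c where "c = z \<bullet> (S *\<^sub>v z) - \<mu> * a"
  have a_eq: "a = z \<bullet> (S *\<^sub>v v) - \<mu> * (z \<bullet> v)"
    unfolding a_def using z v(1) Sv by (subst (2) z_def) (simp add: scalar_prod_minus_distrib[of _ n])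
  have cross: "v \<bullet> (S *\<^sub>v z) = z \<bullet> (S *\<^sub>v v)"
    using transpose_vec_mult_scalar[OF S z v(1)] sym comm_scalar_prod[OF z Sv] by simp
  have comm: "v \<bullet> z = z \<bullet> v" using comm_scalar_prod[OF v(1) z] .
  \<comment> \<open>Compare the form at \<open>v + t z\<close> with its bound by
    \<open>\<mu>\<close>: the constant terms cancel, and the linear coefficient is
    \<open>2 * a\<close> by \<open>a_eq\<close>.\<close>
  have ineq: "2 * t * a + t * t * c \<le> 0" for t
  proof -
    let ?w = "v + t \<cdot>\<^sub>v z"
    have w: "?w \<in> carrier_vec n" using v z by simp
    have Sw: "S *\<^sub>v ?w = S *\<^sub>v v + t \<cdot>\<^sub>v (S *\<^sub>v z)"
      using S v(1) z by (simp add: mult_add_distrib_mat_vec[of _ n n] mult_mat_vec[of _ n n])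
    have "?w \<bullet> (S *\<^sub>v ?w) = \<mu> + 2 * t * (z \<bullet> (S *\<^sub>v v)) + t * t * (z \<bullet> (S *\<^sub>v z))"
      unfolding Sw using v(1) z Sv Sz cross
      by (simp add: add_scalar_prod_distrib[of _ n] scalar_prod_add_distrib[of _ n] \<mu>_def
          algebra_simps)
    moreover have "?w \<bullet> ?w = 1 + 2 * t * (z \<bullet> v) + t * t * a"
      using v(1,2) z comm
      by (simp add: add_scalar_prod_distrib[of _ n] scalar_prod_add_distrib[of _ n] a_def
          algebra_simps)
    moreover have "?w \<bullet> (S *\<^sub>v ?w) \<le> \<mu> * (?w \<bullet> ?w)"
      using v(3)[OF w] by (simp add: \<mu>_def)
    ultimately show ?thesis
      unfolding c_def by (subst (1) a_eq) (simp add: algebra_simps)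
  qed
  have a0: "a \<ge> 0" by (simp add: a_def scalar_prod_self_nonneg)
  have "a = 0"
  proof (rule ccontr)
    assume "a \<noteq> 0"
    \<comment> \<open>This \<open>t\<close> is small enough that
      \<open>t * \<bar>c\<bar> \<le> a\<close>, so the quadratic term cannot cancel
      \<open>2 * a\<close>.\<close>
    define t where "t = a / (1 + \<bar>c\<bar>)"
    have t: "t > 0" using a0 \<open>a \<noteq> 0\<close> by (simp add: t_def)
    have "t * (2 * a + t * c) \<le> 0"
      using ineq[of t] by (simp add: algebra_simps)
    then have "2 * a + t * c \<le> 0" using t by (simp add: mult_le_0_iff)
    moreover have "t * c \<ge> - (t * \<bar>c\<bar>)" using t
      by (metis abs_ge_minus_self abs_mult abs_of_pos minus_le_iff)
    moreover have "t * \<bar>c\<bar> \<le> a"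
      unfolding t_def using a0 by (simp add: divide_le_eq field_simps)
    ultimately show False using a0 \<open>a \<noteq> 0\<close> by linarith
  qed
  then have z0: "z = 0\<^sub>v n" using scalar_prod_self_eq_0[of z n] z by (simp add: a_def)
  have "S *\<^sub>v v = \<mu> \<cdot>\<^sub>v v"
  proof (rule eq_vecI)
    fix i assume "i < dim_vec (\<mu> \<cdot>\<^sub>v v)"
    then have i: "i < n" using v(1) by simp
    have "z $ i = 0" using z0 i by simp
    then show "(S *\<^sub>v v) $ i = (\<mu> \<cdot>\<^sub>v v) $ i"
      unfolding z_def using i v(1) Sv by (simp del: index_mult_mat_vec)
  qed (use S v(1) in auto)
  then show thesis using that v \<mu>_def by blast
qed

section \<open>Spectrum and quadratic forms\<close>

lemma spectrum_eigenvector: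
  fixes A :: "real mat"
  assumes "A \<in> carrier_mat n n" "\<mu> \<in> spectrum A"
  obtains v where "v \<in> carrier_vec n" "v \<bullet> v > 0" "A *\<^sub>v v = \<mu> \<cdot>\<^sub>v v"
proof -
  obtain v where v: "v \<in> carrier_vec n" "v \<noteq> 0\<^sub>v n" "A *\<^sub>v v = \<mu> \<cdot>\<^sub>v v"
    using assms by (auto simp: spectrum_def eigenvalue_def eigenvector_def)
  then have "v \<bullet> v > 0"
    using scalar_prod_self_nonneg[of v] scalar_prod_self_eq_0[of v n] by fastforce
  then show thesis using that v by blast
qed

lemma spectrumI:
  fixes A :: "real mat"
  assumes "A \<in> carrier_mat n n" "v \<in> carrier_vec n" "v \<bullet> v = 1" "A *\<^sub>v v = \<mu> \<cdot>\<^sub>v v"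
  shows "\<mu> \<in> spectrum A"
  using assms by (auto simp: spectrum_def eigenvalue_def eigenvector_def intro!: exI[of _ v])

text \<open>The maximal Rayleigh quotient is itself an eigenvalue, so the spectrum is nonempty;
  being finite, it has a maximum, which is at least this quotient.\<close>

lemma lambda_max_symmetric:
  fixes M :: "real mat"
  assumes M: "M \<in> carrier_mat n n" and sym: "M\<^sup>T = M" and n: "n > 0"
  shows lambda_max_in_spectrum: "lambda_max M \<in> spectrum M"
    and quadratic_form_le_lambda_max:
      "w \<in> carrier_vec n \<Longrightarrow> w \<bullet> (M *\<^sub>v w) \<le> lambda_max M * (w \<bullet> w)"
proof -
  obtain \<mu> v where v: "v \<in> carrier_vec n" "v \<bullet> v = 1" "M *\<^sub>v v = \<mu> \<cdot>\<^sub>v v"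
    "\<And>w. w \<in> carrier_vec n \<Longrightarrow> w \<bullet> (M *\<^sub>v w) \<le> \<mu> * (w \<bullet> w)"
    using symmetric_top_eigenvector[OF M sym n] by blast
  have mem: "\<mu> \<in> spectrum M" using spectrumI[OF M v(1-3)] .
  have fin: "finite (spectrum M)" using card_finite_spectrum(1)[OF M] .
  show "lambda_max M \<in> spectrum M"
    unfolding lambda_max_def using mem fin by (intro Max_in) auto
  show "w \<bullet> (M *\<^sub>v w) \<le> lambda_max M * (w \<bullet> w)" if "w \<in> carrier_vec n"
  proof -
    have "\<mu> \<le> lambda_max M" unfolding lambda_max_def using mem fin by simp
    then show ?thesis
      using v(4)[OF that] mult_right_mono[OF _ scalar_prod_self_nonneg[of w]] by fastforce
  qed
qed

section \<open>The Gram matrix and its extreme eigenvalues\<close>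

context
  fixes A :: "real mat" and m n :: nat
  assumes A: "A \<in> carrier_mat m n"
begin

lemma gram_carrier: "gram A \<in> carrier_mat n n"
  using A by (simp add: gram_def)

lemma gram_symmetric: "(gram A)\<^sup>T = gram A"
  using transpose_mult[of "A\<^sup>T" n m A n] A by (simp add: gram_def)

lemma gram_mult_vec: "v \<in> carrier_vec n \<Longrightarrow> gram A *\<^sub>v v = A\<^sup>T *\<^sub>v (A *\<^sub>v v)"
  using assoc_mult_mat_vec[of "A\<^sup>T" n m A n v] A by (simp add: gram_def)

lemma gram_quadratic_form:
  assumes "v \<in> carrier_vec n"
  shows "v \<bullet> (gram A *\<^sub>v v) = (A *\<^sub>v v) \<bullet> (A *\<^sub>v v)"
proof -
  have Av: "A *\<^sub>v v \<in> carrier_vec m" using A assms by simp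
  have "v \<bullet> (A\<^sup>T *\<^sub>v (A *\<^sub>v v)) = (A\<^sup>T *\<^sub>v (A *\<^sub>v v)) \<bullet> v"
    using A assms Av by (intro comm_scalar_prod[of _ n]) auto
  then show ?thesis
    using transpose_vec_mult_scalar[OF A assms Av] gram_mult_vec[OF assms] by simp
qed

lemma gram_eigenvalue_nonneg:
  assumes "\<mu> \<in> spectrum (gram A)"
  shows "\<mu> \<ge> 0"
proof -
  obtain v where v: "v \<in> carrier_vec n" "v \<bullet> v > 0" "gram A *\<^sub>v v = \<mu> \<cdot>\<^sub>v v"
    using spectrum_eigenvector[OF gram_carrier assms] .
  have "\<mu> * (v \<bullet> v) = (A *\<^sub>v v) \<bullet> (A *\<^sub>v v)"
    using gram_quadratic_form[OF v(1)] v by simp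
  then have "\<mu> * (v \<bullet> v) \<ge> 0" using scalar_prod_self_nonneg by simp
  then show ?thesis using v(2) by (simp add: zero_le_mult_iff)
qed

lemma lambda_max_gram_nonneg: "n > 0 \<Longrightarrow> lambda_max (gram A) \<ge> 0"
  using gram_eigenvalue_nonneg lambda_max_in_spectrum[OF gram_carrier gram_symmetric] by blast

lemma mult_vec_le_lambda_max:
  assumes "n > 0" "v \<in> carrier_vec n"
  shows "(A *\<^sub>v v) \<bullet> (A *\<^sub>v v) \<le> lambda_max (gram A) * (v \<bullet> v)"
  using quadratic_form_le_lambda_max[OF gram_carrier gram_symmetric assms]
    gram_quadratic_form[OF assms(2)] by simp

text \<open>Apply \<open>symmetric_top_eigenvector\<close> to \<open>c P - A\<^sup>T A\<close>, where \<open>P\<close> is the projection onto the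
  row space and \<open>c\<close> exceeds the spectrum of \<open>A\<^sup>T A\<close>: its top eigenvalue is \<open>c\<close> minus the least
  positive eigenvalue of \<open>A\<^sup>T A\<close>, and the eigenvector lies in the row space.\<close>

lemma row_space_eigenvector:
  assumes nz: "A \<noteq> 0\<^sub>m m n"
  obtains \<nu> where "\<nu> > 0" "\<nu> \<in> spectrum (gram A)"
    "\<And>e. e \<in> carrier_vec n \<Longrightarrow> row_proj A e = e \<Longrightarrow> \<nu> * (e \<bullet> e) \<le> (A *\<^sub>v e) \<bullet> (A *\<^sub>v e)"
proof -
  obtain i j where ij: "i < m" "j < n" "A $$ (i, j) \<noteq> 0"
    using nz A by (metis carrier_matD eq_matI index_zero_mat zero_carrier_mat)
  then have n: "n > 0" by simp
  \<comment> \<open>The summand 1 makes the quadratic form of \<open>S\<close> at least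
    \<open>u \<bullet> u\<close> at \<open>u\<close> in the row space, so the top eigenvalue of
    \<open>S\<close> is positive.\<close>
  define c where "c = lambda_max (gram A) + 1"
  define S where "S = c \<cdot>\<^sub>m (pinv A * A) - gram A"
  have Q: "pinv A * A \<in> carrier_mat n n" using pinv_mult_carrier[OF A] .
  have S: "S \<in> carrier_mat n n" unfolding S_def using gram_carrier by (rule minus_carrier_mat)
  have smult_tr: "(k \<cdot>\<^sub>m B)\<^sup>T = k \<cdot>\<^sub>m B\<^sup>T" for k and B :: "real mat"
    by (intro eq_matI) auto
  have smult_mv: "(k \<cdot>\<^sub>m B) *\<^sub>v w = k \<cdot>\<^sub>v (B *\<^sub>v w)"
    if "dim_col B = dim_vec w" for k and B :: "real mat" and w
    using that by (intro eq_vecI) (auto simp: scalar_prod_def sum_distrib_left mult.assoc)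
  have sym: "S\<^sup>T = S"
    using transpose_minus[of "c \<cdot>\<^sub>m (pinv A * A)" n n "gram A"] Q gram_carrier gram_symmetric
      pinv_mult_symmetric[OF A]
    by (simp add: S_def smult_tr)
  have S_vec: "S *\<^sub>v w = c \<cdot>\<^sub>v row_proj A w - gram A *\<^sub>v w" if "w \<in> carrier_vec n" for w
    using that Q gram_carrier A
    by (simp add: S_def row_proj_def minus_mult_distrib_mat_vec[of _ n n] smult_mv)
  obtain \<mu> v where v: "v \<in> carrier_vec n" "v \<bullet> v = 1" "S *\<^sub>v v = \<mu> \<cdot>\<^sub>v v"
    and top: "\<And>w. w \<in> carrier_vec n \<Longrightarrow> w \<bullet> (S *\<^sub>v w) \<le> \<mu> * (w \<bullet> w)"
    using symmetric_top_eigenvector[OF S sym n] by blast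
  have range_le: "c * (e \<bullet> e) - (A *\<^sub>v e) \<bullet> (A *\<^sub>v e) \<le> \<mu> * (e \<bullet> e)"
    if e: "e \<in> carrier_vec n" "row_proj A e = e" for e
  proof -
    have "gram A *\<^sub>v e \<in> carrier_vec n" using gram_carrier e(1) by simp
    then have "e \<bullet> (S *\<^sub>v e) = c * (e \<bullet> e) - (A *\<^sub>v e) \<bullet> (A *\<^sub>v e)"
      using e gram_quadratic_form[OF e(1)]
      by (simp add: S_vec scalar_prod_minus_distrib[of _ n])
    then show ?thesis using top[OF e(1)] by simp
  qed
  \<comment> \<open>A nonzero vector of the row space: \<open>A u\<close> has the nonzero entry
    \<open>A $$ (i, j)\<close> at index \<open>i\<close>.\<close>
  define u where "u = row_proj A (unit_vec n j)"
  have u: "u \<in> carrier_vec n" "row_proj A u = u"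
    using row_proj_carrier[OF A] row_proj_idem[OF A] by (simp_all add: u_def)
  have "A *\<^sub>v u = A *\<^sub>v unit_vec n j" using mult_row_proj[OF A] by (simp add: u_def)
  moreover have "(A *\<^sub>v unit_vec n j) $ i \<noteq> 0" using A ij by simp
  ultimately have "(A *\<^sub>v u) $ i \<noteq> 0" by simp
  moreover have "(A *\<^sub>v 0\<^sub>v n) $ i = 0" using A ij(1) by simp
  ultimately have "u \<noteq> 0\<^sub>v n" by metis
  then have u_pos: "u \<bullet> u > 0"
    using u(1) scalar_prod_self_nonneg[of u] scalar_prod_self_eq_0[of u n] by fastforce
  have "u \<bullet> u \<le> \<mu> * (u \<bullet> u)"
    using range_le[OF u] mult_vec_le_lambda_max[OF n u(1)] by (simp add: c_def distrib_right)
  then have \<mu>: "\<mu> > 0" using u_pos mult_nonpos_nonneg[of \<mu> "u \<bullet> u"] by linarith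
  have gv: "gram A *\<^sub>v v \<in> carrier_vec n" using gram_carrier v(1) by simp
  have proj_gv: "row_proj A (gram A *\<^sub>v v) = gram A *\<^sub>v v"
    using row_proj_transpose[OF A] gram_mult_vec[OF v(1)] A v(1) by simp
  \<comment> \<open>Both terms of \<open>S\<close> map into the row space, so
    \<open>S v = \<mu> v\<close> with \<open>\<mu> > 0\<close> forces \<open>v\<close> into
    it.\<close>
  have "row_proj A (S *\<^sub>v v) = S *\<^sub>v v"
  proof -
    have "row_proj A (S *\<^sub>v v) = c \<cdot>\<^sub>v row_proj A (row_proj A v) - row_proj A (gram A *\<^sub>v v)"
      unfolding S_vec[OF v(1)]
      using Q gv row_proj_carrier[OF A, of v]
      unfolding row_proj_def[of A "_ - _"] row_proj_def[of A "row_proj _ _"] row_proj_def[of A "_ *\<^sub>v _"]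
      by (simp add: mult_minus_distrib_mat_vec[of _ n n] mult_mat_vec[of _ n n])
    then show ?thesis
      using S_vec[OF v(1)] row_proj_idem[OF A v(1)] proj_gv by simp
  qed
  then have "row_proj A (\<mu> \<cdot>\<^sub>v v) = \<mu> \<cdot>\<^sub>v v" using v(3) by simp
  then have "\<mu> \<cdot>\<^sub>v row_proj A v = \<mu> \<cdot>\<^sub>v v"
    using mult_mat_vec[OF Q v(1)] by (simp add: row_proj_def)
  then have "(1 / \<mu>) \<cdot>\<^sub>v (\<mu> \<cdot>\<^sub>v row_proj A v) = (1 / \<mu>) \<cdot>\<^sub>v (\<mu> \<cdot>\<^sub>v v)" by simp
  then have proj_v: "row_proj A v = v"
    using \<mu> by (simp add: smult_smult_assoc)
  define \<nu> where "\<nu> = c - \<mu>"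
  have eig: "gram A *\<^sub>v v = \<nu> \<cdot>\<^sub>v v"
  proof (rule eq_vecI)
    fix i assume "i < dim_vec (\<nu> \<cdot>\<^sub>v v)"
    then have i: "i < n" using v(1) by simp
    have "(S *\<^sub>v v) $ i = (\<mu> \<cdot>\<^sub>v v) $ i" using v(3) by simp
    then show "(gram A *\<^sub>v v) $ i = (\<nu> \<cdot>\<^sub>v v) $ i"
      unfolding S_vec[OF v(1)] proj_v using i v(1) gram_carrier
      by (simp add: \<nu>_def left_diff_distrib del: index_mult_mat_vec)
  qed (use gram_carrier v(1) in simp_all)
  \<comment> \<open>On the row space \<open>A\<close> is injective, since there
    \<open>v = pinv A (A v)\<close>; this makes \<open>\<nu>\<close> strictly positive.\<close>
  have "A *\<^sub>v v \<noteq> 0\<^sub>v m"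
  proof
    assume "A *\<^sub>v v = 0\<^sub>v m"
    moreover have "pinv A *\<^sub>v 0\<^sub>v m = 0\<^sub>v n"
      using pinv_carrier[OF A] by (intro eq_vecI) auto
    ultimately have "v = 0\<^sub>v n"
      using proj_v assoc_mult_mat_vec[OF pinv_carrier[OF A] A v(1)] pinv_carrier[OF A]
      by (simp add: row_proj_def)
    then show False using v(2) by simp
  qed
  then have "(A *\<^sub>v v) \<bullet> (A *\<^sub>v v) > 0"
    using A v(1) scalar_prod_self_nonneg[of "A *\<^sub>v v"] scalar_prod_self_eq_0[of "A *\<^sub>v v" m]
    by fastforce
  moreover have "\<nu> = (A *\<^sub>v v) \<bullet> (A *\<^sub>v v)"
    using gram_quadratic_form[OF v(1)] v(1,2) eig by simp
  ultimately have "\<nu> > 0" by simp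
  moreover have "\<nu> \<in> spectrum (gram A)"
    using spectrumI[OF gram_carrier v(1,2) eig] .
  moreover have "\<nu> * (e \<bullet> e) \<le> (A *\<^sub>v e) \<bullet> (A *\<^sub>v e)"
    if "e \<in> carrier_vec n" "row_proj A e = e" for e
    using range_le[OF that] by (simp add: \<nu>_def left_diff_distrib)
  ultimately show thesis using that by blast
qed

text \<open>The eigenvalue \<open>\<nu>\<close> of \<open>row_space_eigenvector\<close> makes the
  set under \<open>Min\<close> nonempty, and the bound passes from \<open>\<nu>\<close> to
  \<open>Min\<close>, which is at most \<open>\<nu>\<close>.\<close>

lemma lambda_min_pos_gram:
  assumes "A \<noteq> 0\<^sub>m m n"
  shows lambda_min_pos_gram_pos: "lambda_min_pos (gram A) > 0"
    and lambda_min_pos_le_mult_vec: "e \<in> carrier_vec n \<Longrightarrow> row_proj A e = e \<Longrightarrow>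
      lambda_min_pos (gram A) * (e \<bullet> e) \<le> (A *\<^sub>v e) \<bullet> (A *\<^sub>v e)"
proof -
  obtain \<nu> where \<nu>: "\<nu> > 0" "\<nu> \<in> spectrum (gram A)"
    "\<And>e. e \<in> carrier_vec n \<Longrightarrow> row_proj A e = e \<Longrightarrow> \<nu> * (e \<bullet> e) \<le> (A *\<^sub>v e) \<bullet> (A *\<^sub>v e)"
    using row_space_eigenvector[OF assms] by blast
  let ?E = "{\<mu> \<in> spectrum (gram A). \<mu> > 0}"
  have fin: "finite ?E" using card_finite_spectrum(1)[OF gram_carrier] by simp
  have "Min ?E \<in> ?E" using \<nu> fin by (intro Min_in) auto
  then show "lambda_min_pos (gram A) > 0" by (simp add: lambda_min_pos_def)
  have "lambda_min_pos (gram A) \<le> \<nu>" unfolding lambda_min_pos_def using \<nu> fin by simp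
  then show "lambda_min_pos (gram A) * (e \<bullet> e) \<le> (A *\<^sub>v e) \<bullet> (A *\<^sub>v e)"
    if "e \<in> carrier_vec n" "row_proj A e = e"
    using \<nu>(3)[OF that] mult_right_mono[OF _ scalar_prod_self_nonneg[of e]] by fastforce
qed

end

section \<open>Row submatrices\<close>

text \<open>Used to turn sums over the row numbers of a submatrix into sums over the original
  indices in \<open>I\<close>.\<close>

lemma bij_betw_pick:
  assumes "finite I"
  shows "bij_betw (pick I) {..<card I} I"
proof -
  have "inj_on (pick I) {..<card I}"
    by (rule linorder_inj_onI) (auto dest: pick_mono_le[of _ I] intro: less_imp_neq)
  moreover have "pick I ` {..<card I} \<subseteq> I"
    using pick_in_set_le by auto
  ultimately show ?thesis
    using assms by (simp add: bij_betw_def card_image card_subset_eq)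
qed

context
  fixes A :: "real mat" and m n :: nat and I :: "nat set"
  assumes A: "A \<in> carrier_mat m n" and I: "I \<subseteq> {..<m}"
begin

lemma card_restrict_rows: "card {i. i < m \<and> i \<in> I} = card I"
  using I by (intro arg_cong[of _ _ card]) auto

lemma sub_rows_carrier: "sub_rows A I \<in> carrier_mat (card I) n"
  using A card_restrict_rows by (auto simp: sub_rows_def dim_submatrix)

lemma pick_less: "k < card I \<Longrightarrow> pick I k < m"
  using pick_in_set_le[of k I] I by auto

lemma sub_rows_mult_vec_index:
  assumes "v \<in> carrier_vec n" "k < card I"
  shows "(sub_rows A I *\<^sub>v v) $ k = row A (pick I k) \<bullet> v"
proof -
  have "row (sub_rows A I) k = row A (pick I k)"
    using A assms(2) card_restrict_rows pick_less[OF assms(2)]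
    by (intro eq_vecI) (auto simp: sub_rows_def submatrix_index dim_submatrix pick_UNIV)
  then show ?thesis
    using sub_rows_carrier assms(2) by simp
qed

lemma sub_rows_mult_vec_norm:
  assumes "v \<in> carrier_vec n"
  shows "(sub_rows A I *\<^sub>v v) \<bullet> (sub_rows A I *\<^sub>v v) = (\<Sum>i\<in>I. (row A i \<bullet> v)\<^sup>2)"
proof -
  have "finite I" using I finite_subset by blast
  have "(sub_rows A I *\<^sub>v v) \<bullet> (sub_rows A I *\<^sub>v v)
      = (\<Sum>k<card I. (row A (pick I k) \<bullet> v)\<^sup>2)"
    using sub_rows_carrier sub_rows_mult_vec_index[OF assms]
    by (simp add: scalar_prod_def[of "_ *\<^sub>v _"] lessThan_atLeast0 power2_eq_square
        del: index_mult_mat_vec)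
  also have "\<dots> = (\<Sum>i\<in>I. (row A i \<bullet> v)\<^sup>2)"
    using sum.reindex_bij_betw[OF bij_betw_pick[OF \<open>finite I\<close>]] .
  finally show ?thesis .
qed

lemma sub_rows_mult_vec_cong:
  assumes "u \<in> carrier_vec n" "v \<in> carrier_vec n" "A *\<^sub>v u = A *\<^sub>v v"
  shows "sub_rows A I *\<^sub>v u = sub_rows A I *\<^sub>v v"
proof (rule eq_vecI)
  fix k assume "k < dim_vec (sub_rows A I *\<^sub>v v)"
  then have k: "k < card I" using sub_rows_carrier by simp
  have "(A *\<^sub>v u) $ pick I k = (A *\<^sub>v v) $ pick I k" using assms(3) by simp
  then show "(sub_rows A I *\<^sub>v u) $ k = (sub_rows A I *\<^sub>v v) $ k"
    using sub_rows_mult_vec_index[OF assms(1) k] sub_rows_mult_vec_index[OF assms(2) k]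
      pick_less[OF k] A
    by simp
qed simp

lemma sub_vec_mult_vec:
  assumes "z \<in> carrier_vec n"
  shows "sub_vec (A *\<^sub>v z) I = sub_rows A I *\<^sub>v z"
proof (rule eq_vecI)
  fix k assume "k < dim_vec (sub_rows A I *\<^sub>v z)"
  then have k: "k < card I" using sub_rows_carrier by simp
  have "sub_vec (A *\<^sub>v z) I $ k = (A *\<^sub>v z) $ pick I k"
    using A k card_restrict_rows by (simp add: sub_vec_def)
  then show "sub_vec (A *\<^sub>v z) I $ k = (sub_rows A I *\<^sub>v z) $ k"
    using sub_rows_mult_vec_index[OF assms k] pick_less[OF k] A by simp
qed (use A card_restrict_rows sub_rows_carrier in \<open>simp add: sub_vec_def\<close>)

text \<open>Let \<open>H\<close> and \<open>Q\<close> project onto the row spaces of the submatrix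
  and of \<open>A\<close>. The submatrix agrees on \<open>w\<close> and \<open>Q w\<close>, so
  \<open>H Q = H\<close>, and taking adjoints gives \<open>Q H = H\<close>. The adjoint step is done
  by testing against vectors, finally the difference \<open>d\<close> against itself.\<close>

lemma row_proj_sub_rows:
  assumes e: "e \<in> carrier_vec n"
  shows "row_proj A (row_proj (sub_rows A I) e) = row_proj (sub_rows A I) e"
proof -
  note B = sub_rows_carrier
  let ?H = "row_proj (sub_rows A I)" and ?Q = "row_proj A"
  have HQ: "?H (?Q w) = ?H w" if "w \<in> carrier_vec n" for w
  proof -
    have "sub_rows A I *\<^sub>v ?Q w = sub_rows A I *\<^sub>v w"
      using that row_proj_carrier[OF A] mult_row_proj[OF A that] by (intro sub_rows_mult_vec_cong)
    then show ?thesis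
      using assoc_mult_mat_vec[OF pinv_carrier[OF B] B that]
        assoc_mult_mat_vec[OF pinv_carrier[OF B] B row_proj_carrier[OF A, of w]]
      by (simp add: row_proj_def)
  qed
  have He: "?H e \<in> carrier_vec n" and QHe: "?Q (?H e) \<in> carrier_vec n"
    using row_proj_carrier[OF A] row_proj_carrier[OF B] by auto
  have weak: "w \<bullet> ?Q (?H e) = w \<bullet> ?H e" if w: "w \<in> carrier_vec n" for w
  proof -
    have "w \<bullet> ?Q (?H e) = ?H (?Q w) \<bullet> e"
      using row_proj_symmetric[OF A w He] row_proj_symmetric[OF B row_proj_carrier[OF A] e, of w]
      by simp
    then show ?thesis using HQ[OF w] row_proj_symmetric[OF B w e] by simp
  qed
  define d where "d = ?Q (?H e) - ?H e"
  have d: "d \<in> carrier_vec n" using He QHe by (simp add: d_def)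
  have "d \<bullet> d = 0"
    using weak[OF d] d He QHe
    by (subst (2) d_def) (simp add: scalar_prod_minus_distrib[of _ n])
  then have d0: "d = 0\<^sub>v n" using scalar_prod_self_eq_0 d by blast
  show ?thesis
  proof (rule eq_vecI)
    fix i assume "i < dim_vec (?H e)"
    then have i: "i < n" using He by simp
    have "d $ i = 0" using d0 i by simp
    then show "?Q (?H e) $ i = ?H e $ i" using i He QHe by (simp add: d_def)
  qed (use He QHe in auto)
qed

text \<open>With \<open>b = A z\<close> the residual on \<open>I\<close> is \<open>B (z - x)\<close>
  for \<open>B = sub_rows A I\<close>, and \<open>pinv B\<close> turns it into the projection of
  \<open>z - x\<close>.\<close>

lemma rbskm_step_error:
  assumes z: "z \<in> carrier_vec n" and x: "x \<in> carrier_vec n"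
  shows "rbskm_step A (A *\<^sub>v z) I x - z = (x - z) - row_proj (sub_rows A I) (x - z)"
proof -
  note B = sub_rows_carrier
  let ?B = "sub_rows A I" and ?P = "pinv (sub_rows A I)"
  have car: "?B *\<^sub>v z \<in> carrier_vec (card I)" "?B *\<^sub>v x \<in> carrier_vec (card I)"
    using B z x by auto
  have "?P *\<^sub>v (sub_vec (A *\<^sub>v z) I - ?B *\<^sub>v x) = ?P *\<^sub>v (?B *\<^sub>v z) - ?P *\<^sub>v (?B *\<^sub>v x)"
    unfolding sub_vec_mult_vec[OF z]
    using mult_minus_distrib_mat_vec[OF pinv_carrier[OF B] car] .
  also have "\<dots> = row_proj ?B z - row_proj ?B x"
    using assoc_mult_mat_vec[OF pinv_carrier[OF B] B z] assoc_mult_mat_vec[OF pinv_carrier[OF B] B x]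
    by (simp add: row_proj_def)
  finally have step: "rbskm_step A (A *\<^sub>v z) I x = x + (row_proj ?B z - row_proj ?B x)"
    by (simp add: rbskm_step_def)
  have "row_proj ?B (x - z) = row_proj ?B x - row_proj ?B z"
    using mult_minus_distrib_mat_vec[OF pinv_mult_carrier[OF B] x z] by (simp add: row_proj_def)
  then show ?thesis
    unfolding step using x z carrier_vecD[OF row_proj_carrier[OF B]]
    by (intro eq_vecI) auto
qed

lemma lambda_max_inv_nonneg: "n > 0 \<Longrightarrow> lambda_max_inv (gram (sub_rows A I)) \<ge> 0"
  using lambda_max_gram_nonneg[OF sub_rows_carrier] by (simp add: lambda_max_inv_def)

text \<open>The eigenvalue bound is applied to the projection of \<open>e\<close>, which has the
  same image under the submatrix as \<open>e\<close>. A real \<open>c\<close> below the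
  extended-real inverse also covers \<open>lambda_max = 0\<close>: there the inverse is \<infinity>,
  and \<open>c * 0 \<le> 1\<close>.\<close>

lemma lambda_max_inv_le_row_proj:
  assumes n: "n > 0" and e: "e \<in> carrier_vec n"
    and c: "0 \<le> c" "ereal c \<le> lambda_max_inv (gram (sub_rows A I))"
  shows "c * ((sub_rows A I *\<^sub>v e) \<bullet> (sub_rows A I *\<^sub>v e))
     \<le> row_proj (sub_rows A I) e \<bullet> row_proj (sub_rows A I) e"
proof -
  note B = sub_rows_carrier
  let ?B = "sub_rows A I" and ?L = "lambda_max (gram (sub_rows A I))"
  have L: "?L \<ge> 0" using lambda_max_gram_nonneg[OF B n] .
  let ?h = "row_proj ?B e \<bullet> row_proj ?B e"
  have h0: "?h \<ge> 0" by (rule scalar_prod_self_nonneg)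
  have le: "(?B *\<^sub>v e) \<bullet> (?B *\<^sub>v e) \<le> ?L * ?h"
    using mult_vec_le_lambda_max[OF B n row_proj_carrier[OF B, of e]] mult_row_proj[OF B e] by simp
  have "c * ?L \<le> 1"
  proof (cases "?L = 0")
    case False
    then have "c \<le> 1 / ?L" using c(2) L by (simp add: lambda_max_inv_def one_ereal_def)
    then show ?thesis using False L by (simp add: field_simps)
  qed simp
  then have "c * ?L * ?h \<le> ?h" using mult_right_mono[OF _ h0] by fastforce
  moreover have "c * ((?B *\<^sub>v e) \<bullet> (?B *\<^sub>v e)) \<le> c * (?L * ?h)"
    using mult_left_mono[OF le c(1)] .
  ultimately show ?thesis by (simp add: mult.assoc)
qed

end

section \<open>Blocks\<close>

lemma finite_blocks [simp]: "finite (blocks m \<beta>)"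
  by (rule finite_subset[of _ "Pow {..<m}"]) (auto simp: blocks_def)

lemma card_blocks: "card (blocks m \<beta>) = m choose \<beta>"
  using n_subsets[of "{..<m}" \<beta>] by (simp add: blocks_def)

lemma blocks_nonempty: "\<beta> \<le> m \<Longrightarrow> blocks m \<beta> \<noteq> {}"
  using card_blocks[of m \<beta>] by (auto simp: binomial_eq_0_iff)

lemma block_subset: "\<tau> \<in> blocks m \<beta> \<Longrightarrow> \<tau> \<subseteq> {..<m}"
  by (simp add: blocks_def)

lemma card_blocks_containing:
  assumes "i < m" "\<beta> \<ge> 1"
  shows "card {\<tau> \<in> blocks m \<beta>. i \<in> \<tau>} = (m - 1) choose (\<beta> - 1)"
proof -
  have "bij_betw (insert i) {B. B \<subseteq> {..<m} - {i} \<and> card B = \<beta> - 1} {\<tau> \<in> blocks m \<beta>. i \<in> \<tau>}"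
  proof (rule bij_betw_byWitness[where f' = "\<lambda>\<tau>. \<tau> - {i}"])
    show "insert i ` {B. B \<subseteq> {..<m} - {i} \<and> card B = \<beta> - 1} \<subseteq> {\<tau> \<in> blocks m \<beta>. i \<in> \<tau>}"
    proof
      fix \<tau> assume "\<tau> \<in> insert i ` {B. B \<subseteq> {..<m} - {i} \<and> card B = \<beta> - 1}"
      then obtain B where B: "\<tau> = insert i B" "B \<subseteq> {..<m} - {i}" "card B = \<beta> - 1" by blast
      then have "finite B" "i \<notin> B" using finite_subset by auto
      then show "\<tau> \<in> {\<tau> \<in> blocks m \<beta>. i \<in> \<tau>}"
        using B assms by (auto simp: blocks_def)
    qed
  qed (auto simp: blocks_def)
  then have "card {\<tau> \<in> blocks m \<beta>. i \<in> \<tau>} = card {B. B \<subseteq> {..<m} - {i} \<and> card B = \<beta> - 1}"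
    by (rule bij_betw_same_card[symmetric])
  then show ?thesis using assms by (simp add: n_subsets)
qed

text \<open>Double counting: each row lies in \<open>(m - 1) choose (\<beta> - 1)\<close> blocks,
  and \<open>m\<close> times this number is \<open>\<beta>\<close> times the number of all
  blocks.\<close>

lemma sum_blocks:
  fixes f :: "nat \<Rightarrow> real"
  assumes "\<beta> \<in> {1..m}"
  shows "real m * (\<Sum>\<tau>\<in>blocks m \<beta>. \<Sum>i\<in>\<tau>. f i)
     = real \<beta> * real (card (blocks m \<beta>)) * (\<Sum>i<m. f i)"
proof -
  have "(\<Sum>\<tau>\<in>blocks m \<beta>. \<Sum>i\<in>\<tau>. f i) = (\<Sum>\<tau>\<in>blocks m \<beta>. \<Sum>i\<in>{i\<in>{..<m}. i \<in> \<tau>}. f i)"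
    using block_subset by (intro sum.cong) auto
  also have "\<dots> = (\<Sum>i<m. \<Sum>\<tau>\<in>{\<tau>\<in>blocks m \<beta>. i \<in> \<tau>}. f i)"
    by (rule sum.swap_restrict) auto
  also have "\<dots> = real ((m - 1) choose (\<beta> - 1)) * (\<Sum>i<m. f i)"
    using assms by (simp add: card_blocks_containing sum_distrib_left)
  finally have "real m * (\<Sum>\<tau>\<in>blocks m \<beta>. \<Sum>i\<in>\<tau>. f i)
      = real (m * ((m - 1) choose (\<beta> - 1))) * (\<Sum>i<m. f i)" by simp
  also have "m * ((m - 1) choose (\<beta> - 1)) = \<beta> * card (blocks m \<beta>)"
    using assms times_binomial_minus1_eq[of \<beta> m] by (simp add: card_blocks)
  finally show ?thesis by simp
qed

section \<open>One step of the method\<close>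

locale rbskm_system =
  fixes A :: "real mat" and b z :: "real Matrix.vec" and m n \<beta> \<delta> :: nat
    and sel :: "nat set \<Rightarrow> real Matrix.vec \<Rightarrow> nat set"
  assumes A: "A \<in> carrier_mat m n" and nonzero: "A \<noteq> 0\<^sub>m m n"
    and z: "z \<in> carrier_vec n" and consistent: "A *\<^sub>v z = b"
    and \<beta>: "\<beta> \<in> {1..m}" and \<delta>: "\<delta> \<in> {1..m}"
    and sel: "selection_rule A b \<beta> \<delta> sel"
begin

text \<open>The invariant of the iteration, under which \<open>lambda_min_pos\<close> bounds the
  error by the residual. The locale allows any solution \<open>z\<close>; for
  \<open>z = pinv A b\<close> every starting point in the range of \<open>A\<^sup>T\<close>
  satisfies the invariant.\<close>

definition admissible :: "real Matrix.vec \<Rightarrow> bool" where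
  "admissible x \<longleftrightarrow> x \<in> carrier_vec n \<and> row_proj A (x - z) = x - z"

definition err :: "real Matrix.vec \<Rightarrow> real" where
  "err x = (x - z) \<bullet> (x - z)"

text \<open>By Pythagoras, this is the decrease of \<open>err\<close> when the block
  \<open>\<tau>\<close> is drawn at \<open>x\<close>.\<close>

definition gain :: "nat set \<Rightarrow> real Matrix.vec \<Rightarrow> real" where
  "gain \<tau> x = row_proj (sub_rows A (sel \<tau> x)) (x - z) \<bullet> row_proj (sub_rows A (sel \<tau> x)) (x - z)"

definition res2 :: "real Matrix.vec \<Rightarrow> nat \<Rightarrow> real" where
  "res2 x i = (row A i \<bullet> (x - z))\<^sup>2"

text \<open>The conditional expectation of the next squared error, written as a uniform average so
  that it can be estimated at a fixed \<open>x\<close>; \<open>cond_exp_err_iter\<close> makes the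
  identification.\<close>

definition mean_err :: "real Matrix.vec \<Rightarrow> real" where
  "mean_err x = (\<Sum>\<tau>\<in>blocks m \<beta>. err (rbskm_step A b (sel \<tau> x) x)) / card (blocks m \<beta>)"

lemma n_pos: "n > 0"
proof (rule ccontr)
  assume "\<not> n > 0"
  then have "A = 0\<^sub>m m n" using A by (intro eq_matI) auto
  then show False using nonzero by simp
qed

lemma error_carrier: "x \<in> carrier_vec n \<Longrightarrow> x - z \<in> carrier_vec n"
  using z by simp

lemma res2_eq:
  assumes "x \<in> carrier_vec n" "i < m"
  shows "(row A i \<bullet> x - b $ i)\<^sup>2 = res2 x i" and "(residual A b x i)\<^sup>2 = res2 x i"
proof -
  have "b $ i = row A i \<bullet> z" using consistent A assms(2) by auto
  then have "row A i \<bullet> x - b $ i = row A i \<bullet> (x - z)"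
    using A assms z by (simp add: scalar_prod_minus_distrib[of _ n])
  then show "(row A i \<bullet> x - b $ i)\<^sup>2 = res2 x i" by (simp add: res2_def)
  then show "(residual A b x i)\<^sup>2 = res2 x i"
    by (simp add: residual_def power2_commute)
qed

lemma
  assumes "\<tau> \<in> blocks m \<beta>" "x \<in> carrier_vec n"
  shows sel_subset: "sel \<tau> x \<subseteq> \<tau>"
    and card_sel: "card (sel \<tau> x) = \<delta>"
    and sel_largest: "i \<in> sel \<tau> x \<Longrightarrow> j \<in> \<tau> - sel \<tau> x \<Longrightarrow> res2 x j \<le> res2 x i"
proof -
  have s: "sel \<tau> x \<subseteq> \<tau>" "card (sel \<tau> x) = \<delta>"
    "\<forall>i \<in> sel \<tau> x. \<forall>j \<in> \<tau> - sel \<tau> x. \<bar>residual A b x j\<bar> \<le> \<bar>residual A b x i\<bar>"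
    using sel assms A unfolding selection_rule_def by auto
  show "sel \<tau> x \<subseteq> \<tau>" "card (sel \<tau> x) = \<delta>" by (fact s)+
  show "res2 x j \<le> res2 x i" if "i \<in> sel \<tau> x" "j \<in> \<tau> - sel \<tau> x"
  proof -
    have "\<bar>residual A b x j\<bar> \<le> \<bar>residual A b x i\<bar>" using s(3) that by blast
    then have "(residual A b x j)\<^sup>2 \<le> (residual A b x i)\<^sup>2" by (simp add: abs_le_square_iff)
    moreover have "i < m" "j < m" using that s(1) block_subset[OF assms(1)] by auto
    ultimately show ?thesis using res2_eq(2)[OF assms(2)] by simp
  qed
qed

lemma sel_rows: "\<tau> \<in> blocks m \<beta> \<Longrightarrow> x \<in> carrier_vec n \<Longrightarrow> sel \<tau> x \<subseteq> {..<m}"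
  using sel_subset block_subset by blast

lemma sel_nonempty: "\<tau> \<in> blocks m \<beta> \<Longrightarrow> x \<in> carrier_vec n \<Longrightarrow> sel \<tau> x \<noteq> {}"
  using card_sel[of \<tau> x] \<delta> by auto

lemma finite_sel: "\<tau> \<in> blocks m \<beta> \<Longrightarrow> x \<in> carrier_vec n \<Longrightarrow> finite (sel \<tau> x)"
  using sel_rows finite_subset by blast

lemma rbskm_step_carrier:
  assumes "\<tau> \<in> blocks m \<beta>" "x \<in> carrier_vec n"
  shows "rbskm_step A b (sel \<tau> x) x \<in> carrier_vec n"
  using assms(2) carrier_matD[OF pinv_carrier[OF sub_rows_carrier[OF A sel_rows[OF assms]]]]
  by (intro carrier_vecI) (simp add: rbskm_step_def)

text \<open>The step subtracts from the error a vector of the row space of the selected rows, which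
  \<open>row_proj_sub_rows\<close> places in the row space of \<open>A\<close>.\<close>

lemma admissible_step:
  assumes \<tau>: "\<tau> \<in> blocks m \<beta>" and x: "admissible x"
  shows "admissible (rbskm_step A b (sel \<tau> x) x)"
proof -
  have xc: "x \<in> carrier_vec n" and xp: "row_proj A (x - z) = x - z"
    using x by (simp_all add: admissible_def)
  note I = sel_rows[OF \<tau> xc] and e = error_carrier[OF xc]
  let ?h = "row_proj (sub_rows A (sel \<tau> x)) (x - z)"
  have h: "?h \<in> carrier_vec n" using row_proj_carrier[OF sub_rows_carrier[OF A I]] .
  have "row_proj A ((x - z) - ?h) = row_proj A (x - z) - row_proj A ?h"
    using mult_minus_distrib_mat_vec[OF pinv_mult_carrier[OF A] e h] by (simp add: row_proj_def)
  then have "row_proj A ((x - z) - ?h) = (x - z) - ?h"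
    using xp row_proj_sub_rows[OF A I e] by simp
  then show ?thesis
    using rbskm_step_error[OF A I z xc] rbskm_step_carrier[OF \<tau> xc] consistent
    by (simp add: admissible_def)
qed

lemma err_step:
  assumes \<tau>: "\<tau> \<in> blocks m \<beta>" and x: "x \<in> carrier_vec n"
  shows "err (rbskm_step A b (sel \<tau> x) x) = err x - gain \<tau> x"
  using rbskm_step_error[OF A sel_rows[OF assms] z x] consistent
    row_proj_pythagoras[OF sub_rows_carrier[OF A sel_rows[OF assms]] error_carrier[OF x]]
  by (simp add: err_def gain_def)

lemma card_blocks_pos: "card (blocks m \<beta>) > 0"
  using \<beta> blocks_nonempty[of \<beta> m] by (simp add: card_gt_0_iff)

lemma blocks_ne: "blocks m \<beta> \<noteq> {}"
  using card_blocks_pos by auto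

lemma mean_err_eq:
  assumes "x \<in> carrier_vec n"
  shows "mean_err x = err x - (\<Sum>\<tau>\<in>blocks m \<beta>. gain \<tau> x) / card (blocks m \<beta>)"
  using blocks_ne err_step[OF _ assms]
  by (simp add: mean_err_def sum_subtractf diff_divide_distrib)

lemma err_nonneg: "err x \<ge> 0" and gain_nonneg: "gain \<tau> x \<ge> 0" and res2_nonneg: "res2 x i \<ge> 0"
  by (simp_all add: err_def gain_def res2_def scalar_prod_self_nonneg)

lemma sub_rows_error_norm:
  assumes "I \<subseteq> {..<m}" "x \<in> carrier_vec n"
  shows "(sub_rows A I *\<^sub>v (x - z)) \<bullet> (sub_rows A I *\<^sub>v (x - z)) = (\<Sum>i\<in>I. res2 x i)"
  using sub_rows_mult_vec_norm[OF A assms(1) error_carrier[OF assms(2)]] by (simp add: res2_def)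

lemma norm_mult_vec_rows:
  assumes "v \<in> carrier_vec n"
  shows "(A *\<^sub>v v) \<bullet> (A *\<^sub>v v) = (\<Sum>i<m. (row A i \<bullet> v)\<^sup>2)"
  using A by (simp add: scalar_prod_def[of "_ *\<^sub>v _"] lessThan_atLeast0 power2_eq_square)

lemma lambda_min_pos_le_residual:
  assumes "admissible x"
  shows "lambda_min_pos (gram A) * err x \<le> (\<Sum>i<m. res2 x i)"
  using lambda_min_pos_le_mult_vec[OF A nonzero, of "x - z"] assms error_carrier[of x]
    norm_mult_vec_rows[of "x - z"]
  by (simp add: admissible_def err_def res2_def)

section \<open>The quotient \<open>xi\<close> and the rate estimate\<close>

lemma xi_num_eq:
  assumes x: "x \<in> carrier_vec n"
  shows "xi_num A b \<beta> x = real \<beta> / real m * card (blocks m \<beta>) * (\<Sum>i<m. res2 x i)"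
proof -
  have "xi_num A b \<beta> x = (\<Sum>\<tau>\<in>blocks m \<beta>. \<Sum>i\<in>\<tau>. res2 x i)"
  proof -
    have "(norm2 (sub_rows A \<tau> *\<^sub>v x - sub_vec b \<tau>))\<^sup>2 = (\<Sum>i\<in>\<tau>. res2 x i)"
      if "\<tau> \<in> blocks m \<beta>" for \<tau>
    proof -
      have \<tau>: "\<tau> \<subseteq> {..<m}" using block_subset[OF that] .
      have "sub_rows A \<tau> *\<^sub>v x - sub_vec b \<tau> = sub_rows A \<tau> *\<^sub>v (x - z)"
        using mult_minus_distrib_mat_vec[OF sub_rows_carrier[OF A \<tau>] x z]
          sub_vec_mult_vec[OF A \<tau> z] consistent by simp
      then show ?thesis using sub_rows_error_norm[OF \<tau> x] by (simp add: norm2_power2)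
    qed
    then show ?thesis using A by (simp add: xi_num_def)
  qed
  moreover have "real m > 0" using \<beta> by simp
  ultimately show ?thesis
    using sum_blocks[OF \<beta>, of "res2 x"] by (simp add: field_simps)
qed

lemma xi_den_eq:
  assumes x: "x \<in> carrier_vec n"
  shows "xi_den A b \<beta> sel x = (\<Sum>\<tau>\<in>blocks m \<beta>. MIN i\<in>sel \<tau> x. res2 x i)"
proof -
  have "(\<lambda>i. (row A i \<bullet> x - b $ i)\<^sup>2) ` sel \<tau> x = res2 x ` sel \<tau> x" if "\<tau> \<in> blocks m \<beta>" for \<tau>
    using res2_eq(1)[OF x] sel_rows[OF that x] by (intro image_cong) auto
  then show ?thesis using A by (simp add: xi_den_def)
qed

lemma min_res2_le:
  assumes "\<tau> \<in> blocks m \<beta>" "x \<in> carrier_vec n"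
  shows "real \<delta> * (MIN i\<in>sel \<tau> x. res2 x i) \<le> (\<Sum>i\<in>sel \<tau> x. res2 x i)"
    and "(MIN i\<in>sel \<tau> x. res2 x i) \<ge> 0"
proof -
  show "real \<delta> * (MIN i\<in>sel \<tau> x. res2 x i) \<le> (\<Sum>i\<in>sel \<tau> x. res2 x i)"
    using sum_bounded_below[of "sel \<tau> x" "MIN i\<in>sel \<tau> x. res2 x i" "res2 x"]
      finite_sel[OF assms] card_sel[OF assms] by simp
  show "(MIN i\<in>sel \<tau> x. res2 x i) \<ge> 0"
    using finite_sel[OF assms] sel_nonempty[OF assms] res2_nonneg by simp
qed

text \<open>A nonzero denominator means that in some block every selected row has a nonzero
  residual. Then the selected submatrix does not annihilate the error, its \<open>lambda_max\<close>
  is nonzero, and the minimum of the inverses is finite.\<close>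

lemma min_lambda_max_inv_real:
  assumes x: "x \<in> carrier_vec n" and den: "xi_den A b \<beta> sel x \<noteq> 0"
  obtains c where "c \<ge> 0" "min_lambda_max_inv A \<beta> sel x = ereal c"
proof -
  let ?L = "\<lambda>\<tau>. lambda_max_inv (gram (sub_rows A (sel \<tau> x)))"
  have min_eq: "min_lambda_max_inv A \<beta> sel x = (MIN \<tau>\<in>blocks m \<beta>. ?L \<tau>)"
    using A by (simp add: min_lambda_max_inv_def)
  obtain \<tau> where \<tau>: "\<tau> \<in> blocks m \<beta>" "(MIN i\<in>sel \<tau> x. res2 x i) \<noteq> 0"
    using den unfolding xi_den_eq[OF x] by (rule sum.not_neutral_contains_not_neutral)
  note I = sel_rows[OF \<tau>(1) x]
  have "lambda_max (gram (sub_rows A (sel \<tau> x))) \<noteq> 0"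
  proof
    assume "lambda_max (gram (sub_rows A (sel \<tau> x))) = 0"
    then have "(\<Sum>i\<in>sel \<tau> x. res2 x i) \<le> 0"
      using mult_vec_le_lambda_max[OF sub_rows_carrier[OF A I] n_pos error_carrier[OF x]]
        sub_rows_error_norm[OF I x] by simp
    then have "\<delta> * (MIN i\<in>sel \<tau> x. res2 x i) \<le> 0" using min_res2_le(1)[OF \<tau>(1) x] by simp
    then show False using min_res2_le(2)[OF \<tau>(1) x] \<tau>(2) \<delta> by (simp add: mult_le_0_iff)
  qed
  then have "?L \<tau> \<noteq> \<infinity>" by (simp add: lambda_max_inv_def one_ereal_def)
  moreover have "(MIN \<tau>\<in>blocks m \<beta>. ?L \<tau>) \<le> ?L \<tau>" using \<tau>(1) by simp
  ultimately have "min_lambda_max_inv A \<beta> sel x \<noteq> \<infinity>" using min_eq by auto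
  moreover have "min_lambda_max_inv A \<beta> sel x \<ge> 0"
    unfolding min_eq using blocks_ne lambda_max_inv_nonneg[OF A sel_rows[OF _ x] n_pos] by simp
  ultimately show thesis using that by (cases "min_lambda_max_inv A \<beta> sel x") auto
qed

text \<open>The average gain is bounded below through \<open>xi_den\<close>, whereas the eigenvalue
  bound controls the error through \<open>xi_num\<close>; \<open>xi\<close> is the exchange rate
  between the two sums. The finite value \<open>c\<close> lets the computation take place in the
  reals.\<close>

lemma mean_err_le:
  assumes x: "admissible x" and den: "xi_den A b \<beta> sel x \<noteq> 0"
  shows "ereal (mean_err x)
    \<le> (1 - ereal (real \<delta> / xi A b \<beta> sel x * (real \<beta> / real m) * lambda_min_pos (gram A))
           * min_lambda_max_inv A \<beta> sel x) * ereal (err x)"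
proof -
  have xc: "x \<in> carrier_vec n" using x by (simp add: admissible_def)
  obtain c where c: "c \<ge> 0" "min_lambda_max_inv A \<beta> sel x = ereal c"
    using min_lambda_max_inv_real[OF xc den] .
  define N where "N = real (card (blocks m \<beta>))"
  define l where "l = lambda_min_pos (gram A)"
  let ?num = "xi_num A b \<beta> x" and ?den = "xi_den A b \<beta> sel x"
  have N: "N > 0" using card_blocks_pos by (simp add: N_def)
  have den_nonneg: "?den \<ge> 0"
    unfolding xi_den_eq[OF xc] by (intro sum_nonneg min_res2_le(2) xc)
  have gain_ge: "c * (\<delta> * (MIN i\<in>sel \<tau> x. res2 x i)) \<le> gain \<tau> x" if \<tau>: "\<tau> \<in> blocks m \<beta>" for \<tau>
  proof -
    note I = sel_rows[OF \<tau> xc]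
    have "ereal c \<le> lambda_max_inv (gram (sub_rows A (sel \<tau> x)))"
      unfolding c(2)[symmetric] min_lambda_max_inv_def using \<tau> A by simp
    then have "c * (\<Sum>i\<in>sel \<tau> x. res2 x i) \<le> gain \<tau> x"
      using lambda_max_inv_le_row_proj[OF A I n_pos error_carrier[OF xc] c(1)]
        sub_rows_error_norm[OF I xc] by (simp add: gain_def)
    then show ?thesis using mult_left_mono[OF min_res2_le(1)[OF \<tau> xc] c(1)] by linarith
  qed
  have "c * \<delta> * ?den = (\<Sum>\<tau>\<in>blocks m \<beta>. c * (\<delta> * (MIN i\<in>sel \<tau> x. res2 x i)))"
    by (simp add: xi_den_eq[OF xc] sum_distrib_left mult.assoc)
  also have "\<dots> \<le> (\<Sum>\<tau>\<in>blocks m \<beta>. gain \<tau> x)" by (intro sum_mono gain_ge)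
  finally have total: "c * \<delta> * ?den / N \<le> (\<Sum>\<tau>\<in>blocks m \<beta>. gain \<tau> x) / N"
    using N by (simp add: divide_right_mono)
  have "real \<beta> / real m * l * err x \<le> real \<beta> / real m * (\<Sum>i<m. res2 x i)"
    using lambda_min_pos_le_residual[OF x] by (simp add: l_def mult.assoc mult_left_mono divide_right_mono)
  also have "\<dots> = ?num / N" using blocks_ne by (simp add: xi_num_eq[OF xc] N_def)
  finally have num: "real \<beta> / real m * l * err x \<le> ?num / N" .
  have num_nonneg: "?num \<ge> 0" unfolding xi_num_def by (simp add: sum_nonneg)
  have "real \<delta> / xi A b \<beta> sel x * (real \<beta> / real m) * l * c * err x
      = (\<delta> * ?den / ?num * c) * (real \<beta> / real m * l * err x)"
    by (simp add: xi_def)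
  also have "\<dots> \<le> (\<delta> * ?den / ?num * c) * (?num / N)"
    using num den_nonneg num_nonneg c(1) by (intro mult_left_mono) simp_all
  \<comment> \<open>For \<open>?num = 0\<close> nothing cancels, but the left side is then
    0.\<close>
  also have "\<dots> \<le> c * \<delta> * ?den / N"
    using N den_nonneg c(1) by (cases "?num = 0") (simp_all add: field_simps)
  also note total
  finally have "mean_err x
      \<le> (1 - real \<delta> / xi A b \<beta> sel x * (real \<beta> / real m) * l * c) * err x"
    unfolding mean_err_eq[OF xc] N_def by (simp add: left_diff_distrib)
  then show ?thesis by (simp add: c(2) l_def one_ereal_def)
qed

text \<open>A block containing the row with the largest residual already removes a fixed fraction of the
  error, whatever \<open>xi_den\<close> is.\<close>

lemma mean_err_contraction:
  obtains \<rho> where "0 \<le> \<rho>" "\<rho> < 1" "\<And>x. admissible x \<Longrightarrow> mean_err x \<le> \<rho> * err x"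
proof -
  define N where "N = real (card (blocks m \<beta>))"
  define l where "l = lambda_min_pos (gram A)"
  \<comment> \<open>The added 1 makes \<open>L\<close> positive, so that it can be divided
    by.\<close>
  define L where "L = lambda_max (gram A) + 1"
  have N: "N > 0" using card_blocks_pos by (simp add: N_def)
  have l: "l > 0" using lambda_min_pos_gram_pos[OF A nonzero] by (simp add: l_def)
  have L: "L > 0" using lambda_max_gram_nonneg[OF A n_pos] by (simp add: L_def)
  have m: "real m > 0" using \<beta> by simp
  \<comment> \<open>The largest squared residual is at least \<open>1 / m\<close> of the sum,
    \<open>L\<close> bounds the quadratic form of the Gram matrix, and \<open>1 / N\<close> is the
    weight of the one block whose gain is kept. The \<open>max\<close> secures
    \<open>0 \<le> \<rho>\<close>.\<close>
  define \<rho> where "\<rho> = max 0 (1 - l / (m * L * N))"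
  have "mean_err x \<le> \<rho> * err x" if x: "admissible x" for x
  proof -
    have xc: "x \<in> carrier_vec n" using x by (simp add: admissible_def)
    have "Max (res2 x ` {..<m}) \<in> res2 x ` {..<m}" using m by (intro Max_in) auto
    then obtain j where j: "j < m" "Max (res2 x ` {..<m}) = res2 x j" by auto
    have j_max: "res2 x i \<le> res2 x j" if "i < m" for i
      unfolding j(2)[symmetric] using that by (intro Max_ge) auto
    have "l * err x \<le> (\<Sum>i<m. res2 x i)" using lambda_min_pos_le_residual[OF x] by (simp add: l_def)
    also have "\<dots> \<le> m * res2 x j" using sum_bounded_above[of "{..<m}" "res2 x" "res2 x j"] j_max by simp
    finally have lower: "l * err x \<le> m * res2 x j" .
    have "\<beta> - 1 \<le> card ({..<m} - {j})" using \<beta> j(1) by (simp add: diff_le_mono)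
    then obtain T where T: "T \<subseteq> {..<m} - {j}" "card T = \<beta> - 1" "finite T"
      using obtain_subset_with_card_n by metis
    define \<tau> where "\<tau> = insert j T"
    have "j \<notin> T" using T(1) by auto
    then have \<tau>: "\<tau> \<in> blocks m \<beta>" using T j(1) \<beta> by (auto simp: \<tau>_def blocks_def)
    note I = sel_rows[OF \<tau> xc]
    let ?h = "row_proj (sub_rows A (sel \<tau> x)) (x - z)"
    \<comment> \<open>If \<open>j\<close> itself is not selected, every selected row has at least
      the residual of \<open>j\<close>.\<close>
    obtain i where i: "i \<in> sel \<tau> x" "res2 x j \<le> res2 x i"
    proof (cases "j \<in> sel \<tau> x")
      case False
      then show thesis
        using that sel_nonempty[OF \<tau> xc] sel_largest[OF \<tau> xc] by (auto simp: \<tau>_def)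
    qed (use that in auto)
    have h: "?h \<in> carrier_vec n" using row_proj_carrier[OF sub_rows_carrier[OF A I]] .
    have "res2 x j \<le> (\<Sum>i\<in>sel \<tau> x. res2 x i)"
      using i member_le_sum[of i "sel \<tau> x" "res2 x"] finite_sel[OF \<tau> xc] res2_nonneg
      by (meson order_trans)
    also have "\<dots> = (sub_rows A (sel \<tau> x) *\<^sub>v ?h) \<bullet> (sub_rows A (sel \<tau> x) *\<^sub>v ?h)"
      using sub_rows_error_norm[OF I xc]
        mult_row_proj[OF sub_rows_carrier[OF A I] error_carrier[OF xc]] by simp
    \<comment> \<open>Passing to all rows of \<open>A\<close> gives a constant independent of the
      selection.\<close>
    also have "\<dots> \<le> (A *\<^sub>v ?h) \<bullet> (A *\<^sub>v ?h)"
      unfolding sub_rows_mult_vec_norm[OF A I h] norm_mult_vec_rows[OF h]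
      by (rule sum_mono2) (use I in auto)
    also have "\<dots> \<le> L * gain \<tau> x"
      using mult_vec_le_lambda_max[OF A n_pos h] scalar_prod_self_nonneg[of ?h]
      by (simp add: L_def gain_def distrib_right)
    also have "\<dots> \<le> L * (\<Sum>\<tau>\<in>blocks m \<beta>. gain \<tau> x)"
      using L \<tau> gain_nonneg by (intro mult_left_mono member_le_sum) auto
    finally have "l * err x \<le> m * (L * (\<Sum>\<tau>\<in>blocks m \<beta>. gain \<tau> x))"
      using lower m by (meson mult_left_mono order_trans less_imp_le)
    then have "l / (m * L * N) * err x \<le> (\<Sum>\<tau>\<in>blocks m \<beta>. gain \<tau> x) / N"
      using m L N by (simp add: field_simps)
    then have "mean_err x \<le> (1 - l / (m * L * N)) * err x"
      unfolding mean_err_eq[OF xc] N_def by (simp add: left_diff_distrib)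
    also have "\<dots> \<le> \<rho> * err x"
      using err_nonneg by (intro mult_right_mono) (simp_all add: \<rho>_def)
    finally show ?thesis .
  qed
  moreover have "\<rho> < 1" using l m L N by (simp add: \<rho>_def)
  moreover have "0 \<le> \<rho>" by (simp add: \<rho>_def)
  ultimately show thesis using that by blast
qed

end

section \<open>Conditional expectations along the random blocks\<close>

lemma rbskm_cong:
  "(\<And>j. j < k \<Longrightarrow> t j = t' j) \<Longrightarrow> rbskm A b sel x0 t k = rbskm A b sel x0 t' k"
  by (induction k) auto

locale rbskm_process = rbskm_system A b z m n \<beta> \<delta> sel + prob_space M
  for A :: "real mat" and b z :: "real Matrix.vec" and m n \<beta> \<delta> :: nat
    and sel :: "nat set \<Rightarrow> real Matrix.vec \<Rightarrow> nat set" and M :: "'w measure" +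
  fixes T :: "nat \<Rightarrow> 'w \<Rightarrow> nat set" and x0 :: "real Matrix.vec"
  assumes uniform: "uniform_blocks M m \<beta> T" and start: "admissible x0"
begin

definition iter :: "nat \<Rightarrow> 'w \<Rightarrow> real Matrix.vec" where
  "iter k \<omega> = rbskm A b sel x0 (\<lambda>j. T j \<omega>) k"

definition past :: "nat \<Rightarrow> 'w \<Rightarrow> nat \<Rightarrow> nat set" where
  "past k \<omega> = (\<lambda>j\<in>{..<k}. T j \<omega>)"

abbreviation pasts :: "nat \<Rightarrow> (nat \<Rightarrow> nat set) set" where
  "pasts k \<equiv> {..<k} \<rightarrow>\<^sub>E blocks m \<beta>"

abbreviation \<F> :: "nat \<Rightarrow> 'w measure" where
  "\<F> k \<equiv> history M m \<beta> T k"

lemma indep_blocks: "indep_vars (\<lambda>_. count_space (blocks m \<beta>)) T UNIV"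
  using uniform by (simp add: uniform_blocks_def)

lemma T_measurable: "T k \<in> measurable M (count_space (blocks m \<beta>))"
  using indep_blocks by (auto simp: indep_vars_def)

lemma T_in_blocks: "\<omega> \<in> space M \<Longrightarrow> T k \<omega> \<in> blocks m \<beta>"
  using measurable_space[OF T_measurable] by simp

text \<open>A finite product of countable discrete spaces is discrete, so every function of
  \<open>past k\<close> is measurable. As there are only finitely many pasts, every real function of
  them is also bounded.\<close>

lemma PiM_blocks: "(\<Pi>\<^sub>M j\<in>{..<k}. count_space (blocks m \<beta>)) = count_space (pasts k)"
  by (rule count_space_PiM_finite) (auto intro: countable_finite)

lemma finite_pasts: "finite (pasts k)"
  by (intro finite_PiE) auto

lemma past_measurable: "past k \<in> measurable M (count_space (pasts k))"
  unfolding past_def PiM_blocks[symmetric] using T_measurable by (intro measurable_restrict)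

lemma past_in_pasts: "\<omega> \<in> space M \<Longrightarrow> past k \<omega> \<in> pasts k"
  using measurable_space[OF past_measurable] by simp

text \<open>Through this, any real quantity computed from the iterate \<open>k\<close> becomes a
  function on a finite discrete space, hence measurable for the history and integrable.\<close>

lemma iter_past: "j \<le> k \<Longrightarrow> iter j \<omega> = rbskm A b sel x0 (past k \<omega>) j"
  unfolding iter_def by (rule rbskm_cong) (simp add: past_def)

lemma admissible_iter: "\<omega> \<in> space M \<Longrightarrow> admissible (iter k \<omega>)"
  by (induction k) (auto simp: iter_def start intro: admissible_step T_in_blocks)

lemma history_eq: "\<F> k = vimage_algebra (space M) (past k) (count_space (pasts k))"
  unfolding history_def PiM_blocks past_def ..

lemma sets_history: "sets (\<F> k) = {past k -` B \<inter> space M | B. B \<subseteq> pasts k}"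
  unfolding history_eq using past_in_pasts by (subst sets_vimage_algebra2) auto

lemma subalgebra_history: "subalgebra M (\<F> k)"
proof -
  have "space (\<F> k) = space M" by (simp add: history_eq)
  then show ?thesis
    using measurable_sets[OF past_measurable] by (auto simp: subalgebra_def sets_history)
qed

lemma past_measurable_history: "(\<lambda>\<omega>. u (past k \<omega>)) \<in> borel_measurable (\<F> k)"
  for u :: "_ \<Rightarrow> real"
  unfolding history_eq
  using past_in_pasts
  by (intro measurable_compose[OF measurable_vimage_algebra1 borel_measurable_count_space]) auto

lemma past_measurable_borel: "(\<lambda>\<omega>. u (past k \<omega>)) \<in> borel_measurable M"
  for u :: "_ \<Rightarrow> real"
  by (rule measurable_compose[OF past_measurable borel_measurable_count_space])

lemma past_integrable: "integrable M (\<lambda>\<omega>. u (past k \<omega>))"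
  for u :: "_ \<Rightarrow> real"
proof (rule integrable_const_bound[where B = "Max ((\<lambda>h. norm (u h)) ` pasts k)"])
  show "AE \<omega> in M. norm (u (past k \<omega>)) \<le> Max ((\<lambda>h. norm (u h)) ` pasts k)"
    using finite_pasts past_in_pasts by (intro AE_I2 Max_ge) auto
qed (rule past_measurable_borel)

sublocale hist: finite_measure_subalgebra M "\<F> k" for k
  by unfold_locales (rule subalgebra_history)

section \<open>Independence and conditional expectation\<close>

definition event :: "nat \<Rightarrow> nat set \<Rightarrow> 'w set" where
  "event k \<tau> = {\<omega> \<in> space M. T k \<omega> = \<tau>}"

lemma event_sets: "event k \<tau> \<in> events"
proof -
  have "event k \<tau> = T k -` ({\<tau>} \<inter> blocks m \<beta>) \<inter> space M"
    using T_in_blocks by (auto simp: event_def)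
  then show ?thesis using measurable_sets[OF T_measurable, of "{\<tau>} \<inter> blocks m \<beta>"] by simp
qed

lemma prob_event:
  assumes "\<tau> \<in> blocks m \<beta>"
  shows "prob (event k \<tau>) = 1 / card (blocks m \<beta>)"
proof -
  have "event k \<tau> = T k -` {\<tau>} \<inter> space M" by (auto simp: event_def)
  then have "prob (event k \<tau>) = measure (distr M (count_space (blocks m \<beta>)) (T k)) {\<tau>}"
    using assms T_measurable by (subst measure_distr) auto
  also have "\<dots> = 1 / card (blocks m \<beta>)"
    using assms uniform by (simp add: uniform_blocks_def measure_uniform_count_measure)
  finally show ?thesis .
qed

text \<open>Independence is applied to the two groups of indices \<open>{..<k}\<close> and
  \<open>{k}\<close>. A single block then appears as a function on \<open>{k}\<close>, and
  \<open>S\<close> collects those with value \<open>\<tau>\<close>.\<close>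

lemma prob_past_event:
  assumes B: "B \<subseteq> pasts k"
  shows "prob (past k -` B \<inter> space M \<inter> event k \<tau>) = prob (past k -` B \<inter> space M) * prob (event k \<tau>)"
proof -
  let ?C = "\<lambda>_. count_space (blocks m \<beta>)"
  have ind: "indep_var (PiM {..<k} ?C) (past k) (PiM {k} ?C) (\<lambda>\<omega>. \<lambda>j\<in>{k}. T j \<omega>)"
    unfolding past_def by (rule indep_var_restrict[OF indep_blocks]) auto
  have Bs: "B \<in> sets (PiM {..<k} ?C)" using B by (simp add: PiM_blocks)
  define S where "S = {k} \<rightarrow>\<^sub>E ({\<tau>} \<inter> blocks m \<beta>)"
  have Ss: "S \<in> sets (PiM {k} ?C)" unfolding S_def by (intro sets_PiM_I_finite) auto
  have ev: "(\<lambda>\<omega>. \<lambda>j\<in>{k}. T j \<omega>) -` S \<inter> space M = event k \<tau>"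
    using T_in_blocks by (auto simp: S_def event_def PiE_iff)
  have "(\<lambda>\<omega>. (past k \<omega>, \<lambda>j\<in>{k}. T j \<omega>)) -` (B \<times> S) \<inter> space M
      = past k -` B \<inter> space M \<inter> event k \<tau>"
    unfolding ev[symmetric] by auto
  then show ?thesis using indep_varD[OF ind Bs Ss] ev by simp
qed

text \<open>A constant is measurable for the history, so it remains to compare integrals over
  history events; these are preimages of sets of pasts, for which \<open>prob_past_event\<close>
  factorises the probability.\<close>

lemma cond_exp_event:
  assumes \<tau>: "\<tau> \<in> blocks m \<beta>"
  shows "AE \<omega> in M. real_cond_exp M (\<F> k) (indicator (event k \<tau>)) \<omega> = 1 / card (blocks m \<beta>)"
proof (rule hist.real_cond_exp_charact)
  fix S assume "S \<in> sets (\<F> k)"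
  then obtain B where B: "B \<subseteq> pasts k" "S = past k -` B \<inter> space M" by (auto simp: sets_history)
  have S: "S \<in> events" using measurable_sets[OF past_measurable] B by simp
  have "(\<integral>\<omega>\<in>S. indicator (event k \<tau>) \<omega> \<partial>M) = prob (S \<inter> event k \<tau>)"
    using S event_sets sets.sets_into_space[OF S]
    by (simp add: set_lebesgue_integral_def indicator_inter_arith[symmetric] Int_absorb1 Int_absorb2 inf.coboundedI1)
  also have "\<dots> = prob S * (1 / card (blocks m \<beta>))"
    unfolding B(2) prob_past_event[OF B(1)] prob_event[OF \<tau>] ..
  also have "\<dots> = (\<integral>\<omega>\<in>S. 1 / card (blocks m \<beta>) \<partial>M)"
    using S by (simp add: set_lebesgue_integral_def)
  finally show "(\<integral>\<omega>\<in>S. indicator (event k \<tau>) \<omega> \<partial>M) = (\<integral>\<omega>\<in>S. 1 / card (blocks m \<beta>) \<partial>M)" .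
qed (use event_sets in \<open>auto intro!: integrable_real_indicator simp: emeasure_eq_measure\<close>)

lemma err_iter_integrable: "integrable M (\<lambda>\<omega>. err (iter k \<omega>))"
  unfolding iter_past[OF order_refl] by (rule past_integrable)

text \<open>The next error is split by the value of the block drawn. For a fixed
  \<open>\<tau>\<close> it depends on the past only and can be taken out of the conditional
  expectation; the remaining indicator contributes
  \<open>1 / card (blocks m \<beta>)\<close>.\<close>

lemma cond_exp_err_iter:
  "AE \<omega> in M. real_cond_exp M (\<F> k) (\<lambda>\<omega>. err (iter (Suc k) \<omega>)) \<omega> = mean_err (iter k \<omega>)"
proof -
  define next_err where "next_err \<tau> \<omega> = err (rbskm_step A b (sel \<tau> (iter k \<omega>)) (iter k \<omega>))" for \<tau> \<omega>
  have next_hist: "next_err \<tau> \<in> borel_measurable (\<F> k)" for \<tau>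
    unfolding next_err_def iter_past[OF order_refl] by (rule past_measurable_history)
  have next_int: "integrable M (next_err \<tau>)" for \<tau>
    unfolding next_err_def iter_past[OF order_refl] by (rule past_integrable)
  have prod_int: "integrable M (\<lambda>\<omega>. next_err \<tau> \<omega> * indicator (event k \<tau>) \<omega>)" for \<tau>
    using integrable_mult_indicator[OF event_sets next_int, of k \<tau>] by (simp add: mult.commute)
  have split: "err (iter (Suc k) \<omega>) = (\<Sum>\<tau>\<in>blocks m \<beta>. next_err \<tau> \<omega> * indicator (event k \<tau>) \<omega>)"
    if \<omega>: "\<omega> \<in> space M" for \<omega>
  proof -
    have "(\<Sum>\<tau>\<in>blocks m \<beta>. next_err \<tau> \<omega> * indicator (event k \<tau>) \<omega>)
        = (\<Sum>\<tau>\<in>blocks m \<beta>. if \<tau> = T k \<omega> then next_err \<tau> \<omega> else 0)"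
      using \<omega> by (intro sum.cong) (auto simp: event_def)
    also have "\<dots> = next_err (T k \<omega>) \<omega>" using T_in_blocks[OF \<omega>] by simp
    finally show ?thesis by (simp add: next_err_def iter_def)
  qed
  have "AE \<omega> in M. real_cond_exp M (\<F> k) (\<lambda>\<omega>. err (iter (Suc k) \<omega>)) \<omega>
      = real_cond_exp M (\<F> k) (\<lambda>\<omega>. \<Sum>\<tau>\<in>blocks m \<beta>. next_err \<tau> \<omega> * indicator (event k \<tau>) \<omega>) \<omega>"
    by (intro hist.real_cond_exp_cong AE_I2 split borel_measurable_sum
        borel_measurable_integrable err_iter_integrable prod_int)
  moreover have "AE \<omega> in M. real_cond_exp M (\<F> k)
        (\<lambda>\<omega>. \<Sum>\<tau>\<in>blocks m \<beta>. next_err \<tau> \<omega> * indicator (event k \<tau>) \<omega>) \<omega>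
      = (\<Sum>\<tau>\<in>blocks m \<beta>. real_cond_exp M (\<F> k) (\<lambda>\<omega>. next_err \<tau> \<omega> * indicator (event k \<tau>) \<omega>) \<omega>)"
    by (rule hist.real_cond_exp_sum[OF prod_int])
  moreover have "AE \<omega> in M. \<forall>\<tau>\<in>blocks m \<beta>.
      real_cond_exp M (\<F> k) (\<lambda>\<omega>. next_err \<tau> \<omega> * indicator (event k \<tau>) \<omega>) \<omega>
      = next_err \<tau> \<omega> / card (blocks m \<beta>)"
  proof (rule AE_finite_allI)
    fix \<tau> assume \<tau>: "\<tau> \<in> blocks m \<beta>"
    have "AE \<omega> in M. real_cond_exp M (\<F> k) (\<lambda>\<omega>. next_err \<tau> \<omega> * indicator (event k \<tau>) \<omega>) \<omega>
        = next_err \<tau> \<omega> * real_cond_exp M (\<F> k) (indicator (event k \<tau>)) \<omega>"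
      by (rule hist.real_cond_exp_mult[OF next_hist _ prod_int]) (use event_sets in auto)
    then show "AE \<omega> in M. real_cond_exp M (\<F> k) (\<lambda>\<omega>. next_err \<tau> \<omega> * indicator (event k \<tau>) \<omega>) \<omega>
        = next_err \<tau> \<omega> / card (blocks m \<beta>)"
      using cond_exp_event[OF \<tau>, of k] by eventually_elim simp
  qed simp
  ultimately show ?thesis
    by eventually_elim (simp add: mean_err_def next_err_def sum_divide_distrib)
qed

text \<open>The tower property: integrating a conditional expectation gives back the full
  expectation.\<close>

lemma expectation_err_iter:
  "expectation (\<lambda>\<omega>. err (iter (Suc k) \<omega>)) = expectation (\<lambda>\<omega>. mean_err (iter k \<omega>))"
proof -
  have "expectation (\<lambda>\<omega>. err (iter (Suc k) \<omega>))
      = expectation (real_cond_exp M (\<F> k) (\<lambda>\<omega>. err (iter (Suc k) \<omega>)))"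
    using hist.real_cond_exp_int(2)[OF err_iter_integrable] by simp
  also have "\<dots> = expectation (\<lambda>\<omega>. mean_err (iter k \<omega>))"
  proof (rule integral_cong_AE)
    show "(\<lambda>\<omega>. mean_err (iter k \<omega>)) \<in> borel_measurable M"
      unfolding iter_past[OF order_refl] by (rule past_measurable_borel)
  qed (use cond_exp_err_iter in auto)
  finally show ?thesis .
qed

lemma err_iter_converges: "converges_linearly_in_expectation M iter z"
proof -
  obtain \<rho> where \<rho>: "0 \<le> \<rho>" "\<rho> < 1" "\<And>x. admissible x \<Longrightarrow> mean_err x \<le> \<rho> * err x"
    using mean_err_contraction by blast
  have "expectation (\<lambda>\<omega>. err (iter (Suc k) \<omega>)) \<le> \<rho> * expectation (\<lambda>\<omega>. err (iter k \<omega>))" for k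
  proof -
    have "integrable M (\<lambda>\<omega>. mean_err (iter k \<omega>))"
      unfolding iter_past[OF order_refl] by (rule past_integrable)
    then have "expectation (\<lambda>\<omega>. mean_err (iter k \<omega>)) \<le> expectation (\<lambda>\<omega>. \<rho> * err (iter k \<omega>))"
      using err_iter_integrable \<rho>(3) admissible_iter by (intro integral_mono) auto
    then show ?thesis unfolding expectation_err_iter by simp
  qed
  moreover have "(norm2 (x - z))\<^sup>2 = err x" for x by (simp add: norm2_power2 err_def)
  ultimately show ?thesis
    using err_iter_integrable \<rho>(1,2) by (auto simp: converges_linearly_in_expectation_def)
qed

lemma cond_exp_err_iter_le:
  "AE \<omega> in M. xi_den A b \<beta> sel (iter k \<omega>) \<noteq> 0 \<longrightarrow>
     ereal (real_cond_exp M (\<F> k) (\<lambda>\<omega>. err (iter (Suc k) \<omega>)) \<omega>)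
     \<le> (1 - ereal (real \<delta> / xi A b \<beta> sel (iter k \<omega>) * (real \<beta> / real m) * lambda_min_pos (gram A))
             * min_lambda_max_inv A \<beta> sel (iter k \<omega>))
       * ereal (err (iter k \<omega>))"
  using cond_exp_err_iter[of k] AE_space
  by eventually_elim (use mean_err_le admissible_iter in auto)

end

theorem theorem1:
  fixes A :: "real mat" and b x0 xs :: "real Matrix.vec" and m n \<beta> \<delta> :: nat
    and sel :: "nat set \<Rightarrow> real Matrix.vec \<Rightarrow> nat set"
    and M :: "'w measure" and T :: "nat \<Rightarrow> 'w \<Rightarrow> nat set"
    and X :: "nat \<Rightarrow> 'w \<Rightarrow> real Matrix.vec"
  assumes "A \<in> carrier_mat m n" and "A \<noteq> 0\<^sub>m m n" and "m \<ge> n"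
    and "b \<in> carrier_vec m"
    and "\<exists>x \<in> carrier_vec n. A *\<^sub>v x = b"
    and "\<beta> \<in> {1..m}" and "\<delta> \<in> {1..m}" and "\<delta> \<le> \<beta>"
    and "x0 \<in> vec_space.col_space n (transpose_mat A)"
    and "selection_rule A b \<beta> \<delta> sel"
    and "prob_space M" and "uniform_blocks M m \<beta> T"
  defines "xs \<equiv> pinv A *\<^sub>v b"
    and "X \<equiv> \<lambda>k \<omega>. rbskm A b sel x0 (\<lambda>j. T j \<omega>) k"
  shows "converges_linearly_in_expectation M X xs \<and>
    (\<forall>k. AE \<omega> in M. xi_den A b \<beta> sel (X k \<omega>) \<noteq> 0 \<longrightarrow>
       ereal (real_cond_exp M (history M m \<beta> T k) (\<lambda>\<omega>'. (norm2 (X (Suc k) \<omega>' - xs))\<^sup>2) \<omega>)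
       \<le> (1 - ereal (real \<delta> / xi A b \<beta> sel (X k \<omega>) * (real \<beta> / real m) * lambda_min_pos (gram A))
               * min_lambda_max_inv A \<beta> sel (X k \<omega>))
         * ereal ((norm2 (X k \<omega> - xs))\<^sup>2))"
proof -
  note A = assms(1)
  obtain x where x: "x \<in> carrier_vec n" "A *\<^sub>v x = b" using assms(5) by blast
  \<comment> \<open>For any solution \<open>x\<close>, \<open>pinv A b = pinv A (A x)\<close> is the
    projection of \<open>x\<close>: again a solution, and an element of the row space.\<close>
  have xs_eq: "xs = row_proj A x"
    using assoc_mult_mat_vec[OF pinv_carrier[OF A] A x(1)] x(2) by (simp add: xs_def row_proj_def)
  have xs: "xs \<in> carrier_vec n" unfolding xs_eq by (rule row_proj_carrier[OF A])
  have xs_sol: "A *\<^sub>v xs = b" unfolding xs_eq using mult_row_proj[OF A x(1)] x(2) by simp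
  obtain y where y: "y \<in> carrier_vec m" "A\<^sup>T *\<^sub>v y = x0"
    using assms(9) A vec_space.col_space_eq[of "A\<^sup>T" n m] by auto
  have x0: "x0 \<in> carrier_vec n" using A y by auto
  have "row_proj A (x0 - xs) = row_proj A x0 - row_proj A xs"
    using mult_minus_distrib_mat_vec[OF pinv_mult_carrier[OF A] x0 xs] by (simp add: row_proj_def)
  also have "\<dots> = x0 - xs"
    using row_proj_transpose[OF A y(1)] y(2) row_proj_idem[OF A x(1)] by (simp add: xs_eq)
  finally have start: "row_proj A (x0 - xs) = x0 - xs" .
  interpret rbskm_system A b xs m n \<beta> \<delta> sel
    using assms xs xs_sol by unfold_locales
  interpret prob_space M by fact
  interpret rbskm_process A b xs m n \<beta> \<delta> sel M T x0
    using assms(12) x0 start by unfold_locales (simp_all add: admissible_def)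
  have "X = iter" by (simp add: X_def iter_def fun_eq_iff)
  moreover have "(norm2 (v - xs))\<^sup>2 = err v" for v by (simp add: norm2_power2 err_def)
  ultimately show ?thesis
    using err_iter_converges cond_exp_err_iter_le by simp
qed

end
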